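(* Let $f=f_1+\mathrm{i}f_2$ be a piecewise continuous function without zeros, where $f_1$ is real, $2\pi$-periodic and even and $f_2$ is real, $2\pi$-periodic and odd, having points of discontinuity $\xi_1,\xi_2,\dots,\xi_\nu\in(0,2\pi]$ with bounded jumps $\alpha_k=\lim_{x\to\xi_k^+}f(x)-\lim_{x\to\xi_k^-}f(x)$. Then the singular values of the preconditioned matrix $\mathcal{C}_n^{-1}(f)T_n(f)$ are clustered around $1$ in the sense of general clustering; namely, for every $\varepsilon>0$, $\mathcal{O}(\log n)$ singular values lie outside $[1-\varepsilon,1+\varepsilon]$.
   Context: $T_n(f)$ is the $n\times n$ Toeplitz matrix with $(j,k)$ entry $\frac{1}{2\pi}\int_{-\pi}^{\pi}f(x)\mathrm{e}^{-\mathrm{i}(j-k)x}\,\mathrm{d}x$. $\mathcal{C}_n(f)=\mathcal{F}_n^H\Lambda_n(f)\mathcal{F}_n$ is the circulant matrix with eigenvalues $f\left(\frac{2\pi(k-1)}{n}\right)$, $k=1,\dots,n$, where $\Lambda_n(f)$ is the diagonal matrix of these values (in this order) and $\mathcal{F}_n=\frac{1}{\sqrt n}\left(\omega^{(j-1)(k-1)}\right)_{j,k=1}^n$, $\omega=\mathrm{e}^{2\pi\mathrm{i}/n}$; $\mathcal{C}_n^{-1}(f)=(\mathcal{C}_n(f))^{-1}$. General clustering around a point means that for each $\varepsilon>0$ the number of singular values of the $n\times n$ matrix at distance more than $\varepsilon$ from the point is $o(n)$.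
   Formalization: "Without zeros" is taken to mean that f(x) and all one-sided limits of f are nonzero; with only f(x) ≠ 0 the O(log n) claim fails, e.g. for f(0)=1, f(x)=exp(-1/x^2) for 0<|x|≤π. *)

theory Defs
  imports
    "HOL-Analysis.Analysis"
    "HOL-Library.Landau_Symbols"
    "Jordan_Normal_Form.Schur_Decomposition"
    "Jordan_Normal_Form.Gauss_Jordan_Elimination"
begin

text \<open>
  Matrices have rows and columns indexed from 0, so the indices below are those of the usual
  1-based formulas shifted by one; the differences \<open>j - k\<close> are unaffected.
\<close>

definition toeplitz_mat :: "(real \<Rightarrow> complex) \<Rightarrow> nat \<Rightarrow> complex mat" where
  "toeplitz_mat f n = Matrix.mat n n (\<lambda>(j, k).
     1 / (2 * complex_of_real pi) *
     integral {-pi..pi} (\<lambda>x. f x * exp (- \<i> * of_int (int j - int k) * complex_of_real x)))"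

definition fourier_mat :: "nat \<Rightarrow> complex mat" where
  "fourier_mat n = (1 / complex_of_real (sqrt (real n))) \<cdot>\<^sub>m
     Matrix.mat n n (\<lambda>(j, k). exp (2 * complex_of_real pi * \<i> / of_nat n) ^ (j * k))"

definition sample_diag_mat :: "(real \<Rightarrow> complex) \<Rightarrow> nat \<Rightarrow> complex mat" where
  "sample_diag_mat f n =
     Matrix.mat n n (\<lambda>(j, k). if j = k then f (2 * pi * real k / real n) else 0)"

definition circulant_mat :: "(real \<Rightarrow> complex) \<Rightarrow> nat \<Rightarrow> complex mat" where
  "circulant_mat f n = mat_adjoint (fourier_mat n) * sample_diag_mat f n * fourier_mat n"

text \<open>
  \<^const>\<open>mat_inverse\<close> returns an option; \<^const>\<open>the\<close> is harmless here, because
  \<open>circulant_mat f n\<close> is invertible as soon as \<open>f\<close> vanishes nowhere.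
\<close>

definition preconditioned_mat :: "(real \<Rightarrow> complex) \<Rightarrow> nat \<Rightarrow> complex mat" where
  "preconditioned_mat f n = the (mat_inverse (circulant_mat f n)) * toeplitz_mat f n"

text \<open>
  The singular values, with multiplicity: square roots of the eigenvalues of \<open>A\<^sup>H A\<close>. These
  eigenvalues are nonnegative reals, so taking the real part loses nothing.
\<close>

definition singular_values :: "complex mat \<Rightarrow> real multiset" where
  "singular_values A =
     image_mset (\<lambda>z. sqrt (Re z)) (proots (char_poly (mat_adjoint A * A)))"

definition general_clustering :: "(nat \<Rightarrow> complex mat) \<Rightarrow> real \<Rightarrow> bool" where
  "general_clustering A c \<longleftrightarrow>
     (\<forall>\<epsilon>>0. (\<lambda>n. real (size {# \<sigma> \<in># singular_values (A n). \<bar>\<sigma> - c\<bar> > \<epsilon> #})) \<in> o(\<lambda>n. real n))"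

text \<open>
  At a discontinuity \<open>\<xi>\<close> the value \<open>f \<xi>\<close> is unrelated to the limits \<open>f(\<xi>-)\<close> and \<open>f(\<xi>+)\<close>, so for a
  piecewise continuous function ``without zeros'' has to cover these limits as well: it means
  that \<open>f\<close> is bounded away from 0 on a period. Nonvanishing of the values alone would not suffice
  for a logarithmic bound, as the example \<open>f 0 = 1\<close>, \<open>f x = exp (- 1 / x^2)\<close> for \<open>0 < \<bar>x\<bar> \<le> pi\<close> shows:
  there at least \<open>c n^(2/3)\<close> of the singular values tend to infinity.
\<close>

definition without_zeros :: "(real \<Rightarrow> complex) \<Rightarrow> bool" where
  "without_zeros f \<longleftrightarrow>
     (\<forall>x. f x \<noteq> 0 \<and> \<not> (f \<longlongrightarrow> 0) (at_left x) \<and> \<not> (f \<longlongrightarrow> 0) (at_right x))"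

text \<open>
  \<open>\<xi> 1, \<dots>, \<xi> \<nu>\<close> are the points of discontinuity in the period \<open>(0, 2\<pi>]\<close>, with finite one-sided
  limits and jumps \<open>\<alpha> 1, \<dots>, \<alpha> \<nu>\<close>. The values of \<open>f\<close> at these points are arbitrary.
\<close>

definition piecewise_continuous_with_jumps ::
  "(real \<Rightarrow> complex) \<Rightarrow> nat \<Rightarrow> (nat \<Rightarrow> real) \<Rightarrow> (nat \<Rightarrow> complex) \<Rightarrow> bool" where
  "piecewise_continuous_with_jumps f \<nu> \<xi> \<alpha> \<longleftrightarrow>
     inj_on \<xi> {1..\<nu>} \<and>
     {x \<in> {0<..2 * pi}. \<not> isCont f x} = \<xi> ` {1..\<nu>} \<and>
     (\<forall>k \<in> {1..\<nu>}. \<exists>l r. (f \<longlongrightarrow> l) (at_left (\<xi> k)) \<and> (f \<longlongrightarrow> r) (at_right (\<xi> k)) \<and> \<alpha> k = r - l)"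

end

theory Submission
  imports Defs "HOL-Real_Asymp.Real_Asymp"
begin

text \<open>
  The singular values of an \<open>n \<times> n\<close> matrix \<open>A\<close> are the numbers \<open>\<parallel>A u\<parallel>\<close>, where \<open>u\<close> runs through some
  orthonormal basis (\<open>singular_values_conv_vnorm\<close>). For \<open>A = C\<^sup>-\<^sup>1 T\<close>, with the circulant matrix \<open>C\<close> and the Toeplitz
  matrix \<open>T\<close> of \<open>f\<close>, a singular value at distance more than \<open>\<epsilon>\<close> from \<open>1\<close> means \<open>\<parallel>(A - 1) u\<parallel> > \<epsilon>\<close>. As
  \<open>A - 1 = C\<^sup>-\<^sup>1 (T - C)\<close> and \<open>\<bar>f\<bar> \<ge> c > 0\<close> on a period (\<open>regulated_bounded_below\<close>), this forces \<open>\<parallel>(T - C) u\<parallel> > c \<epsilon>\<close>.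

  The function \<open>f\<close> has one-sided limits everywhere, so it is a uniform limit of step functions: \<open>f = s + g\<close> with a
  step function \<open>s\<close> and \<open>\<bar>g\<bar> \<le> c \<epsilon> / 4\<close> (\<open>regulated_step_approx\<close>). The Toeplitz and the circulant matrix of \<open>g\<close> have
  operator norm at most \<open>c \<epsilon> / 4\<close> each (\<open>vnorm_toeplitz_le\<close>, \<open>vnorm_circulant_le\<close>). Hence \<open>\<parallel>E u\<parallel> \<ge> c \<epsilon> / 2\<close> for
  \<open>E = T(s) - C(s)\<close>, and by orthonormality the number of such \<open>u\<close> is at most \<open>4 / (c \<epsilon>)\<^sup>2\<close> times the squared Frobenius
  norm of \<open>E\<close> (\<open>card_large_columns_le\<close>).

  It remains to see that this squared norm is \<open>O(log n)\<close>. The entries of \<open>E\<close> are differences of Fourier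
  coefficients of \<open>s\<close> and their Riemann sums over \<open>n\<close> sample points. For the indicator function of an interval both
  are explicit geometric expressions, and their difference is at most \<open>K / (n - \<bar>m\<bar>)\<close> for the coefficient of order
  \<open>m\<close> (\<open>small_aliasing_indicator_Ico_0\<close>). So \<open>E\<close> is dominated by multiples of the Hilbert matrix placed in the two corners
  away from the diagonal, and the squared entries of the \<open>n \<times> n\<close> Hilbert matrix sum up to at most twice the harmonic
  number (\<open>frobenius_sq_coeff_mat_le\<close>).
\<close>

unbundle no vec_syntax
unbundle no inner_syntax

section \<open>Adjoints and the Euclidean norm\<close>

lemma dim_mat_adjoint [simp]:
  "dim_row (mat_adjoint A) = dim_col A" "dim_col (mat_adjoint A) = dim_row A"
  by (simp_all add: mat_adjoint_def)

lemma mat_adjoint_carrier [simp]: "A \<in> carrier_mat m n \<Longrightarrow> mat_adjoint A \<in> carrier_mat n m"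
  by (auto intro!: carrier_matI)

lemma index_mat_adjoint [simp]:
  "i < dim_col A \<Longrightarrow> j < dim_row A \<Longrightarrow> mat_adjoint A $$ (i, j) = conjugate (A $$ (j, i))"
  by (simp add: mat_adjoint_def mat_of_rows_index)

lemma mult_square_carrier [simp]:
  "A \<in> carrier_mat n n \<Longrightarrow> B \<in> carrier_mat n n \<Longrightarrow> A * B \<in> carrier_mat n n"
  by (rule mult_carrier_mat)

lemma mat_adjoint_mult:
  fixes A B :: "complex mat"
  assumes "A \<in> carrier_mat l m" "B \<in> carrier_mat m n"
  shows "mat_adjoint (A * B) = mat_adjoint B * mat_adjoint A"
  by (rule eq_matI) (use assms in \<open>auto simp: scalar_prod_def mult.commute\<close>)

lemma mat_adjoint_adjoint [simp]:
  fixes A :: "complex mat"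
  shows "mat_adjoint (mat_adjoint A) = A"
  by (rule eq_matI) auto

lemma adjoint_mult_index:
  fixes A B :: "complex mat"
  assumes "dim_row A = dim_row B" "i < dim_col A" "j < dim_col B"
  shows "(mat_adjoint A * B) $$ (i, j) = col B j \<bullet>c col A i"
  using assms by (auto simp: scalar_prod_def mult.commute)

definition vnorm :: "complex vec \<Rightarrow> real" where
  "vnorm v = L2_set (\<lambda>i. cmod (v $ i)) {0..<dim_vec v}"

lemma vnorm_nonneg [simp]: "0 \<le> vnorm v"
  by (simp add: vnorm_def)

lemma vnorm_power2: "(vnorm v)\<^sup>2 = (\<Sum>i<dim_vec v. (cmod (v $ i))\<^sup>2)"
  by (simp add: vnorm_def L2_set_def sum_nonneg atLeast0LessThan)

lemma self_scalar_prod_eq_vnorm: "v \<bullet>c v = complex_of_real ((vnorm v)\<^sup>2)"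
  unfolding vnorm_power2
  by (simp add: scalar_prod_def complex_norm_square atLeast0LessThan del: of_real_power)

lemma vnorm_add_le:
  assumes "v \<in> carrier_vec n" "w \<in> carrier_vec n"
  shows "vnorm (v + w) \<le> vnorm v + vnorm w"
proof -
  have "vnorm (v + w) = L2_set (\<lambda>i. cmod (v $ i + w $ i)) {0..<n}"
    unfolding vnorm_def using assms by (intro L2_set_cong) auto
  also have "\<dots> \<le> L2_set (\<lambda>i. cmod (v $ i) + cmod (w $ i)) {0..<n}"
    by (intro L2_set_mono norm_triangle_ineq) auto
  also have "\<dots> \<le> vnorm v + vnorm w"
    using assms by (simp add: vnorm_def L2_set_triangle_ineq)
  finally show ?thesis .
qed

lemma adjoint_scalar_prod:
  fixes A :: "complex mat"
  assumes A: "A \<in> carrier_mat m n" and v: "v \<in> carrier_vec n" and w: "w \<in> carrier_vec m"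
  shows "(A *\<^sub>v v) \<bullet>c w = v \<bullet>c (mat_adjoint A *\<^sub>v w)"
proof -
  have "(A *\<^sub>v v) \<bullet>c w = (\<Sum>i<m. \<Sum>j<n. A $$ (i, j) * v $ j * cnj (w $ i))"
    using assms by (simp add: scalar_prod_def atLeast0LessThan sum_distrib_right)
  also have "\<dots> = (\<Sum>j<n. \<Sum>i<m. A $$ (i, j) * v $ j * cnj (w $ i))"
    by (rule sum.swap)
  also have "\<dots> = v \<bullet>c (mat_adjoint A *\<^sub>v w)"
    using assms by (simp add: scalar_prod_def atLeast0LessThan sum_distrib_left mult_ac)
  finally show ?thesis .
qed

lemma vnorm_isometry:
  assumes U: "U \<in> carrier_mat m n" and UU: "mat_adjoint U * U = 1\<^sub>m n" and v: "v \<in> carrier_vec n"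
  shows "vnorm (U *\<^sub>v v) = vnorm v"
proof -
  have "complex_of_real ((vnorm (U *\<^sub>v v))\<^sup>2) = v \<bullet>c (mat_adjoint U *\<^sub>v (U *\<^sub>v v))"
    using adjoint_scalar_prod[OF U v, of "U *\<^sub>v v"] U v by (simp add: self_scalar_prod_eq_vnorm)
  also have "mat_adjoint U *\<^sub>v (U *\<^sub>v v) = v"
    using U UU v by (metis assoc_mult_mat_vec mat_adjoint_carrier one_mult_mat_vec)
  finally have "(vnorm (U *\<^sub>v v))\<^sup>2 = (vnorm v)\<^sup>2"
    unfolding self_scalar_prod_eq_vnorm of_real_eq_iff .
  then show ?thesis by simp
qed

section \<open>Unitary triangularization and singular values\<close>

text \<open>
  Gram--Schmidt applied to a basis that starts with \<open>v\<close> gives orthogonal columns; dividing each by its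
  norm makes them orthonormal, and the first one remains a multiple of \<open>v\<close>.
\<close>
lemma unitary_completion:
  fixes v :: "complex vec"
  assumes v: "v \<in> carrier_vec n" and nv: "v \<noteq> 0\<^sub>v n"
  obtains W c where "W \<in> carrier_mat n n" "mat_adjoint W * W = 1\<^sub>m n" "c \<noteq> 0" "col W 0 = c \<cdot>\<^sub>v v"
proof -
  interpret cof_vec_space n "TYPE(complex)" .
  note bc = basis_completion[OF v nv]
  define ws where "ws = gram_schmidt n (basis_completion v)"
  note gs = gram_schmidt_result[OF bc(2,4,5) ws_def]
  have n: "0 < n" using v nv by (cases n) auto
  have len: "length ws = n" using gs bc by simp
  have hd: "ws ! 0 = v"
  proof -
    obtain vs where "basis_completion v = v # vs"
      using bc(6,7) n by (cases "basis_completion v") auto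
    then have "hd ws = v" using gram_schmidt_hd[OF v] ws_def by simp
    then show ?thesis using len n by (cases ws) auto
  qed
  have wsC: "ws ! i \<in> carrier_vec n" if "i < n" for i
    using gs(3) len that by auto
  have orth: "(ws ! i \<bullet>c ws ! j = 0) = (i \<noteq> j)" if "i < n" "j < n" for i j
    using gs(2) len that unfolding corthogonal_def by blast
  have pos: "vnorm (ws ! i) \<noteq> 0" if "i < n" for i
    using orth[OF that that] by (auto simp: self_scalar_prod_eq_vnorm)
  define W where "W = mat_of_cols n (map (\<lambda>w. complex_of_real (1 / vnorm w) \<cdot>\<^sub>v w) ws)"
  have W: "W \<in> carrier_mat n n"
    unfolding W_def using mat_of_cols_carrier(1)[of n "map (\<lambda>w. complex_of_real (1 / vnorm w) \<cdot>\<^sub>v w) ws"] len by simp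
  have colW: "col W i = complex_of_real (1 / vnorm (ws ! i)) \<cdot>\<^sub>v ws ! i" if "i < n" for i
    unfolding W_def using that len wsC[OF that] by (subst col_mat_of_cols) auto
  have "mat_adjoint W * W = 1\<^sub>m n"
  proof (rule eq_matI)
    fix i j assume "i < dim_row (1\<^sub>m n :: complex mat)" "j < dim_col (1\<^sub>m n :: complex mat)"
    then have ij: "i < n" "j < n" by auto
    have "(mat_adjoint W * W) $$ (i, j) = col W j \<bullet>c col W i"
      using W ij by (intro adjoint_mult_index) auto
    also have "\<dots> = complex_of_real (1 / vnorm (ws ! j)) * complex_of_real (1 / vnorm (ws ! i)) * (ws ! j \<bullet>c ws ! i)"
      using wsC[OF ij(1)] wsC[OF ij(2)] ij
      by (simp add: colW conjugate_smult_vec scalar_prod_smult_distrib[of _ n] smult_scalar_prod_distrib[of _ n])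
    also have "\<dots> = (if i = j then 1 else 0)"
      using orth[OF ij(2,1)] pos[OF ij(1)]
      by (auto simp: self_scalar_prod_eq_vnorm power2_eq_square)
    finally show "(mat_adjoint W * W) $$ (i, j) = 1\<^sub>m n $$ (i, j)" using ij by simp
  qed (use W in auto)
  then show thesis
    using that[OF W _ _ colW[OF n, unfolded hd]] pos[OF n] hd by simp
qed

lemma unitary_right:
  fixes U :: "complex mat"
  assumes U: "U \<in> carrier_mat n n" and UU: "mat_adjoint U * U = 1\<^sub>m n"
  shows "U * mat_adjoint U = 1\<^sub>m n"
  using mat_mult_left_right_inverse[OF _ U UU] U by simp

lemma complex_eigenvector_exists:
  fixes A :: "complex mat"
  assumes A: "A \<in> carrier_mat n n" and n: "0 < n"
  obtains v e where "v \<in> carrier_vec n" "v \<noteq> 0\<^sub>v n" "A *\<^sub>v v = e \<cdot>\<^sub>v v"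
proof -
  have "\<not> constant (poly (char_poly A))"
    using degree_monic_char_poly[OF A] n by (simp add: constant_degree)
  then obtain e where "poly (char_poly A) e = 0"
    using fundamental_theorem_of_algebra by blast
  then have "eigenvalue A e" using eigenvalue_root_char_poly[OF A] by simp
  then show thesis using that A unfolding eigenvalue_def eigenvector_def by auto
qed

lemma mat_adjoint_mult_congruence:
  fixes A P Q :: "complex mat"
  assumes A: "A \<in> carrier_mat n n" and P: "P \<in> carrier_mat n n" and Q: "Q \<in> carrier_mat n n"
  shows "mat_adjoint (P * Q) * A * (P * Q) = mat_adjoint Q * (mat_adjoint P * A * P) * Q"
proof -
  note c = assms mat_adjoint_carrier[OF P] mat_adjoint_carrier[OF Q]
  have "mat_adjoint (P * Q) * A * (P * Q) = mat_adjoint Q * mat_adjoint P * A * (P * Q)"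
    by (simp add: mat_adjoint_mult[OF P Q])
  also have "\<dots> = mat_adjoint Q * (mat_adjoint P * A * P) * Q"
    using c by (simp add: assoc_mult_mat[of _ n n _ n _ n])
  finally show ?thesis .
qed

text \<open>
  The triangularizing matrix has to be unitary, not merely invertible: only then are the diagonal entries
  of the triangular form of \<open>A\<^sup>H A\<close> the numbers \<open>\<parallel>A u\<parallel>\<^sup>2\<close> for orthonormal vectors \<open>u\<close>. Induction on the size:
  a unitary matrix whose first column is an eigenvector splits off one diagonal entry.
\<close>
lemma unitary_schur:
  fixes A :: "complex mat"
  assumes "A \<in> carrier_mat n n"
  shows "\<exists>U \<in> carrier_mat n n. mat_adjoint U * U = 1\<^sub>m n \<and> upper_triangular (mat_adjoint U * A * U)"
  using assms
proof (induction n arbitrary: A)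
  case 0
  then show ?case by (intro bexI[of _ "1\<^sub>m 0"]) (auto intro: eq_matI)
next
  case (Suc n A)
  note A = Suc.prems
  obtain v e where v: "v \<in> carrier_vec (Suc n)" "v \<noteq> 0\<^sub>v (Suc n)" and ev: "A *\<^sub>v v = e \<cdot>\<^sub>v v"
    using complex_eigenvector_exists[OF A] by blast
  obtain W c where W: "W \<in> carrier_mat (Suc n) (Suc n)" and WW: "mat_adjoint W * W = 1\<^sub>m (Suc n)"
    and colW: "col W 0 = c \<cdot>\<^sub>v v"
    using unitary_completion[OF v] by metis
  define A' where "A' = mat_adjoint W * A * W"
  have A': "A' \<in> carrier_mat (Suc n) (Suc n)" using A W by (simp add: A'_def)
  have evW: "A *\<^sub>v col W 0 = e \<cdot>\<^sub>v col W 0"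
    using A v ev by (simp add: colW mult_mat_vec smult_smult_assoc mult.commute)
  have first_col: "A' $$ (i, 0) = (if i = 0 then e else 0)" if i: "i < Suc n" for i
  proof -
    have "A' $$ (i, 0) = (mat_adjoint W * (A * W)) $$ (i, 0)"
      unfolding A'_def using A W by (simp add: assoc_mult_mat[of _ "Suc n" "Suc n" _ "Suc n" _ "Suc n"])
    also have "\<dots> = col (A * W) 0 \<bullet>c col W i"
      using A W i by (intro adjoint_mult_index) auto
    also have "col (A * W) 0 = e \<cdot>\<^sub>v col W 0"
      unfolding evW[symmetric] by (rule col_mult2[OF A W]) simp
    also have "(e \<cdot>\<^sub>v col W 0) \<bullet>c col W i = e * (col W 0 \<bullet>c col W i)"
      using W i by (simp add: smult_scalar_prod_distrib[of _ "Suc n"])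
    also have "col W 0 \<bullet>c col W i = (mat_adjoint W * W) $$ (i, 0)"
      using W i by (intro adjoint_mult_index[symmetric]) auto
    finally show ?thesis using i by (simp add: WW)
  qed
  define A1 where "A1 = Matrix.mat 1 1 (\<lambda>_. e)"
  define A2 where "A2 = Matrix.mat 1 n (\<lambda>(i, j). A' $$ (0, Suc j))"
  define A3 where "A3 = Matrix.mat n n (\<lambda>(i, j). A' $$ (Suc i, Suc j))"
  have C: "A1 \<in> carrier_mat 1 1" "A2 \<in> carrier_mat 1 n" "A3 \<in> carrier_mat n n"
    by (simp_all add: A1_def A2_def A3_def)
  have blocks: "A' = four_block_mat A1 A2 (0\<^sub>m n 1) A3"
  proof (rule eq_matI)
    fix i j assume "i < dim_row (four_block_mat A1 A2 (0\<^sub>m n 1) A3)" "j < dim_col (four_block_mat A1 A2 (0\<^sub>m n 1) A3)"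
    then have "i < Suc n" "j < Suc n" using C by auto
    then show "A' $$ (i, j) = four_block_mat A1 A2 (0\<^sub>m n 1) A3 $$ (i, j)"
      using C first_col A' by (cases i; cases j) (auto simp: A1_def A2_def A3_def)
  qed (use A' C in auto)
  obtain P where P: "P \<in> carrier_mat n n" and PP: "mat_adjoint P * P = 1\<^sub>m n"
    and ut: "upper_triangular (mat_adjoint P * A3 * P)"
    using Suc.IH[OF C(3)] by auto
  have P': "mat_adjoint P \<in> carrier_mat n n" using P by simp
  define Q where "Q = four_block_mat (1\<^sub>m 1) (0\<^sub>m 1 n) (0\<^sub>m n 1) P"
  have Q: "Q \<in> carrier_mat (Suc n) (Suc n)" using P by (intro carrier_matI) (auto simp: Q_def)
  have adjQ: "mat_adjoint Q = four_block_mat (1\<^sub>m 1) (0\<^sub>m 1 n) (0\<^sub>m n 1) (mat_adjoint P)"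
    by (rule eq_matI) (use P Q in \<open>auto simp: Q_def\<close>)
  have QQ: "mat_adjoint Q * Q = 1\<^sub>m (Suc n)"
  proof -
    have "mat_adjoint Q * Q = four_block_mat (1\<^sub>m 1) (0\<^sub>m 1 n) (0\<^sub>m n 1) (mat_adjoint P * P)"
      unfolding adjQ unfolding Q_def
      by (subst mult_four_block_mat[of _ 1 1 _ n _ n _ _ 1 _ n]) (use P P' in auto)
    also have "\<dots> = 1\<^sub>m (Suc n)" unfolding PP by (rule eq_matI) auto
    finally show ?thesis .
  qed
  have "mat_adjoint (W * Q) * (W * Q) = mat_adjoint (W * Q) * 1\<^sub>m (Suc n) * (W * Q)"
    using W Q by simp
  also have "\<dots> = mat_adjoint Q * (mat_adjoint W * W) * Q"
    using mat_adjoint_mult_congruence[of "1\<^sub>m (Suc n)" "Suc n", OF _ W Q] W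
    by (metis mat_adjoint_carrier one_carrier_mat right_mult_one_mat)
  also have "\<dots> = 1\<^sub>m (Suc n)" using Q QQ by (simp add: WW right_mult_one_mat[of _ "Suc n" "Suc n"])
  finally have UU: "mat_adjoint (W * Q) * (W * Q) = 1\<^sub>m (Suc n)" .
  have "mat_adjoint (W * Q) * A * (W * Q) = mat_adjoint Q * A' * Q"
    unfolding A'_def by (rule mat_adjoint_mult_congruence[OF A W Q])
  also have "mat_adjoint Q * A' = four_block_mat A1 A2 (0\<^sub>m n 1) (mat_adjoint P * A3)"
    unfolding adjQ unfolding blocks
    by (subst mult_four_block_mat[of _ 1 1 _ n _ n _ _ 1 _ n])
      (use P' C in \<open>auto simp: right_mult_zero_mat[OF P']\<close>)
  also have "\<dots> * Q = four_block_mat A1 (A2 * P) (0\<^sub>m n 1) (mat_adjoint P * A3 * P)"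
    unfolding Q_def
    by (subst mult_four_block_mat[of _ 1 1 _ n _ n _ _ 1 _ n]) (use P P' C in auto)
  finally have "upper_triangular (mat_adjoint (W * Q) * A * (W * Q))"
    using upper_triangular_four_block[OF C(1), of "mat_adjoint P * A3 * P" n] ut C P P'
    by (simp add: A1_def upper_triangular_def)
  then show ?case using UU W Q by (intro bexI[of _ "W * Q"]) auto
qed

text \<open>
  The diagonal of the triangular matrix \<open>U\<^sup>H A\<^sup>H A U\<close> lists the eigenvalues of \<open>A\<^sup>H A\<close> with multiplicity, and its
  \<open>i\<close>-th entry is the scalar product of \<open>A u\<^sub>i\<close> with itself.
\<close>
lemma singular_values_conv_vnorm:
  assumes A: "A \<in> carrier_mat n n"
  obtains U where "U \<in> carrier_mat n n" "mat_adjoint U * U = 1\<^sub>m n"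
    "singular_values A = image_mset (\<lambda>i. vnorm (A *\<^sub>v col U i)) (mset_set {..<n})"
proof -
  define H where "H = mat_adjoint A * A"
  have H: "H \<in> carrier_mat n n" using A by (simp add: H_def)
  obtain U where U: "U \<in> carrier_mat n n" and UU: "mat_adjoint U * U = 1\<^sub>m n"
    and ut: "upper_triangular (mat_adjoint U * H * U)"
    using unitary_schur[OF H] by auto
  define B where "B = mat_adjoint U * H * U"
  have U': "mat_adjoint U \<in> carrier_mat n n" using U by simp
  have B: "B \<in> carrier_mat n n" using H U by (simp add: B_def)
  have "similar_mat_wit B H (mat_adjoint U) U"
    by (rule similar_mat_witI[OF UU unitary_right[OF U UU] B_def B H U' U])
  then have "char_poly H = char_poly B"
    by (metis char_poly_similar similar_mat_def)
  also have "\<dots> = (\<Prod>a\<leftarrow>diag_mat B. [:- a, 1:])"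
    using char_poly_upper_triangular[OF B] ut by (simp add: B_def)
  also have "proots \<dots> = mset (diag_mat B)"
  proof -
    have "proots (\<Prod>a\<leftarrow>xs. [:- a, 1:]) = mset xs" for xs :: "complex list"
    proof (induction xs)
      case (Cons a xs)
      have "(\<Prod>a\<leftarrow>xs. [:- a, 1:]) \<noteq> 0" by (auto simp: prod_list_zero_iff)
      then show ?case using Cons by (simp add: proots_mult del: mult_pCons_left)
    qed simp
    then show ?thesis .
  qed
  finally have "singular_values A = image_mset (\<lambda>i. sqrt (Re (B $$ (i, i)))) (mset [0..<n])"
    using B by (simp add: singular_values_def H_def[symmetric] diag_mat_def image_mset.compositionality comp_def)
  also have "mset [0..<n] = mset_set {..<n}"
    by (simp add: atLeast0LessThan)
  also have "image_mset (\<lambda>i. sqrt (Re (B $$ (i, i)))) (mset_set {..<n})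
    = image_mset (\<lambda>i. vnorm (A *\<^sub>v col U i)) (mset_set {..<n})"
  proof (rule image_mset_cong)
    fix i assume "i \<in># mset_set {..<n}"
    then have i: "i < n" by simp
    have "B = mat_adjoint (A * U) * (A * U)"
      using A U U' by (simp add: B_def H_def mat_adjoint_mult[OF A U] assoc_mult_mat[of _ n n _ n _ n])
    then have "B $$ (i, i) = col (A * U) i \<bullet>c col (A * U) i"
      using A U i by (metis adjoint_mult_index carrier_matD(2) index_mult_mat(3))
    also have "col (A * U) i = A *\<^sub>v col U i"
      by (rule col_mult2[OF A U i])
    finally show "sqrt (Re (B $$ (i, i))) = vnorm (A *\<^sub>v col U i)"
      by (simp add: self_scalar_prod_eq_vnorm del: of_real_power)
  qed
  finally show thesis using that U UU by blast
qed

definition frobenius_sq :: "complex mat \<Rightarrow> real" where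
  "frobenius_sq E = (\<Sum>i<dim_row E. \<Sum>j<dim_col E. (cmod (E $$ (i, j)))\<^sup>2)"

text \<open>
  Right multiplication by a unitary matrix preserves \<open>E E\<^sup>H\<close>, and the diagonal entries of the latter are
  the squared norms of the rows.
\<close>
lemma sum_vnorm_unitary_eq_frobenius_sq:
  assumes E: "E \<in> carrier_mat n n" and U: "U \<in> carrier_mat n n" and UU: "mat_adjoint U * U = 1\<^sub>m n"
  shows "(\<Sum>i<n. (vnorm (E *\<^sub>v col U i))\<^sup>2) = frobenius_sq E"
proof -
  have U': "mat_adjoint U \<in> carrier_mat n n" and E': "mat_adjoint E \<in> carrier_mat n n"
    using U E by auto
  have row: "(\<Sum>j<n. (cmod (M $$ (r, j)))\<^sup>2) = Re ((M * mat_adjoint M) $$ (r, r))"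
    if "M \<in> carrier_mat n n" "r < n" for M r
    using that by (simp add: scalar_prod_def atLeast0LessThan complex_mult_cnj cmod_power2)
  have "(E * U) * mat_adjoint (E * U) = E * (U * mat_adjoint U) * mat_adjoint E"
    using E U U' E' by (simp add: mat_adjoint_mult[OF E U] assoc_mult_mat[of _ n n _ n _ n])
  also have "\<dots> = E * mat_adjoint E"
    using E by (simp add: unitary_right[OF U UU])
  finally have EU: "(E * U) * mat_adjoint (E * U) = E * mat_adjoint E" .
  have "(\<Sum>i<n. (vnorm (E *\<^sub>v col U i))\<^sup>2) = (\<Sum>i<n. \<Sum>r<n. (cmod ((E * U) $$ (r, i)))\<^sup>2)"
    using E U by (simp add: vnorm_power2)
  also have "\<dots> = (\<Sum>r<n. \<Sum>i<n. (cmod ((E * U) $$ (r, i)))\<^sup>2)" by (rule sum.swap)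
  also have "\<dots> = (\<Sum>r<n. Re ((E * mat_adjoint E) $$ (r, r)))"
    using row[OF mult_carrier_mat[OF E U]] by (simp add: EU)
  also have "\<dots> = frobenius_sq E"
    using row[OF E] E by (simp add: frobenius_sq_def)
  finally show ?thesis .
qed

text \<open>
  Chebyshev's inequality for an orthonormal family. It replaces an estimate of rank: a matrix of small
  Frobenius norm can be large on few vectors of an orthonormal basis only.
\<close>
lemma card_large_columns_le:
  assumes E: "E \<in> carrier_mat n n" and U: "U \<in> carrier_mat n n" and UU: "mat_adjoint U * U = 1\<^sub>m n"
    and d: "0 < \<delta>"
  shows "real (card {i. i < n \<and> \<delta> \<le> vnorm (E *\<^sub>v col U i)}) \<le> frobenius_sq E / \<delta>\<^sup>2"
proof -
  let ?S = "{i. i < n \<and> \<delta> \<le> vnorm (E *\<^sub>v col U i)}"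
  have "real (card ?S) * \<delta>\<^sup>2 = (\<Sum>i\<in>?S. \<delta>\<^sup>2)" by simp
  also have "\<dots> \<le> (\<Sum>i\<in>?S. (vnorm (E *\<^sub>v col U i))\<^sup>2)"
    using d by (intro sum_mono power_mono) auto
  also have "\<dots> \<le> (\<Sum>i<n. (vnorm (E *\<^sub>v col U i))\<^sup>2)"
    by (intro sum_mono2) auto
  finally show ?thesis
    using d by (simp add: sum_vnorm_unitary_eq_frobenius_sq[OF E U UU] field_simps)
qed

section \<open>Fourier coefficients of step functions and their samples\<close>

definition fourier_coeff :: "int \<Rightarrow> (real \<Rightarrow> complex) \<Rightarrow> complex" where
  "fourier_coeff m s = integral {0..2 * pi} (\<lambda>x. s x * cis (- of_int m * x)) / complex_of_real (2 * pi)"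

definition sampled_coeff :: "nat \<Rightarrow> int \<Rightarrow> (real \<Rightarrow> complex) \<Rightarrow> complex" where
  "sampled_coeff n m s =
     (\<Sum>k<n. s (2 * pi * real k / real n) * cis (- of_int m * (2 * pi * real k / real n))) / of_nat n"

text \<open>
  Concavity gives \<open>sin y \<ge> 2 y / \<pi>\<close> on the left half of the interval, and the right half follows by reflection.
  The parabola keeps both zeros of the sine, which is what the estimate at both ends needs.
\<close>
lemma sin_ge_parabola:
  assumes "0 \<le> y" "y \<le> pi"
  shows "sin y \<ge> 2 / pi\<^sup>2 * y * (pi - y)"
proof -
  have *: "sin y \<ge> 2 / pi * y" if "0 \<le> y" "y \<le> pi / 2" for y :: real
  proof -
    have "concave_on {0..pi} sin"
    proof (rule f''_le0_imp_concave)
      show "(sin has_real_derivative cos x) (at x)" for x by (rule DERIV_sin)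
      show "(cos has_real_derivative - sin x) (at x)" for x by (rule DERIV_cos)
      show "- sin x \<le> 0" if "x \<in> {0..pi}" for x using that sin_ge_zero[of x] by auto
    qed auto
    then have "convex_on {0..pi} (\<lambda>x. - sin x)" by (simp add: concave_on_def)
    from convex_onD[OF this, of "2 * y / pi" 0 "pi / 2"]
    show ?thesis using that pi_gt_zero by (simp add: field_simps)
  qed
  have **: "sin y \<ge> 2 / pi\<^sup>2 * y * (pi - y)" if "0 \<le> y" "y \<le> pi / 2" for y :: real
  proof -
    have "2 / pi\<^sup>2 * y * (pi - y) \<le> 2 / pi\<^sup>2 * y * pi"
      using that by (intro mult_left_mono) auto
    also have "\<dots> = 2 / pi * y" by (simp add: power2_eq_square)
    finally show ?thesis using *[OF that] by linarith
  qed
  show ?thesis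
  proof (cases "y \<le> pi / 2")
    case True then show ?thesis using ** assms by blast
  next
    case False
    then show ?thesis using **[of "pi - y"] assms by (simp add: mult_ac)
  qed
qed

lemma norm_one_minus_cis: "cmod (1 - cis t) = 2 * \<bar>sin (t / 2)\<bar>"
  using dist_exp_i_1[of t] by (simp add: cis_conv_exp norm_minus_commute)

lemma cis_neq_1:
  assumes "t \<noteq> 0" "\<bar>t\<bar> < 2 * pi"
  shows "cis t \<noteq> 1"
proof
  assume "cis t = 1"
  then have "sin (\<bar>t\<bar> / 2) = 0"
    using norm_one_minus_cis[of t] by (simp add: abs_if split: if_splits)
  then show False using sin_gt_zero[of "\<bar>t\<bar> / 2"] assms by auto
qed

lemma norm_cis_diff_le: "cmod (cis a - cis b) \<le> \<bar>a - b\<bar>"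
proof -
  have "cis a - cis b = cis a * (1 - cis (b - a))"
    by (simp add: algebra_simps cis_mult)
  then have "cmod (cis a - cis b) = 2 * \<bar>sin ((b - a) / 2)\<bar>"
    by (simp only: norm_mult norm_cis norm_one_minus_cis mult_1)
  then show ?thesis using abs_sin_x_le_abs_x[of "(b - a) / 2"] by simp
qed

lemma norm_cis_taylor_le: "cmod (cis t - 1 - \<i> * t) \<le> t\<^sup>2"
  using Taylor_exp[of "\<i> * t" 1] by (simp add: cis_conv_exp diff_diff_eq norm_mult power2_eq_square)

text \<open>
  The pole at \<open>t = 0\<close> cancels, but the poles of \<open>1 / (1 - cis (- t))\<close> at \<open>t = \<plusminus>2\<pi>\<close> stay; they are the source of the factor
  \<open>1 / (n - \<bar>m\<bar>)\<close> in the bound for step functions.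
\<close>
lemma norm_inverse_diff_le:
  assumes "t \<noteq> 0" "\<bar>t\<bar> < 2 * pi"
  shows "cmod (1 / (\<i> * t) - 1 / (1 - cis (- t))) \<le> pi\<^sup>2 / (2 * pi - \<bar>t\<bar>)"
proof -
  define q where "q = \<bar>t\<bar> * (2 * pi - \<bar>t\<bar>) / pi\<^sup>2"
  have q: "0 < q" using assms by (simp add: q_def)
  have "q \<le> 2 * sin (\<bar>t\<bar> / 2)"
    using sin_ge_parabola[of "\<bar>t\<bar> / 2"] assms by (simp add: q_def field_simps)
  also have "\<dots> \<le> cmod (1 - cis (- t))"
    using abs_ge_self[of "sin (t / 2)"] abs_ge_minus_self[of "sin (t / 2)"]
    by (auto simp: norm_one_minus_cis abs_if)
  finally have lower: "q \<le> cmod (1 - cis (- t))" .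
  then have nz: "1 - cis (- t) \<noteq> 0" using q by auto
  have "1 / (\<i> * t) - 1 / (1 - cis (- t)) = - (cis (- t) - 1 - \<i> * (- t)) / (\<i> * t * (1 - cis (- t)))"
    using nz assms by (simp add: field_simps)
  then have "cmod (1 / (\<i> * t) - 1 / (1 - cis (- t))) = cmod (cis (- t) - 1 - \<i> * (- t)) / (\<bar>t\<bar> * cmod (1 - cis (- t)))"
    by (simp only: norm_divide norm_mult norm_minus_cancel norm_of_real norm_ii mult_1)
  also have "\<dots> \<le> t\<^sup>2 / (\<bar>t\<bar> * q)"
    using lower q assms norm_cis_taylor_le[of "- t"]
    by (intro frac_le mult_left_mono) auto
  also have "\<dots> = pi\<^sup>2 / (2 * pi - \<bar>t\<bar>)"
    using assms by (auto simp: q_def power2_eq_square abs_if)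
  finally show ?thesis .
qed

text \<open>
  The \<open>m\<close>-th coefficient of the samples equals the \<open>(m - n)\<close>-th one, so its distance to the \<open>m\<close>-th Fourier
  coefficient cannot be small for \<open>m\<close> near \<open>n\<close> when the coefficients decay only like \<open>1 / m\<close>. The error
  \<open>K / (n - \<bar>m\<bar>)\<close> is what a jump produces. It tolerates all values \<open>\<bar>m\<bar> < n\<close> that occur in an \<open>n \<times> n\<close> matrix
  and is still summable to a logarithm over the matrix.
\<close>
definition small_aliasing :: "(real \<Rightarrow> complex) \<Rightarrow> bool" where
  "small_aliasing s \<longleftrightarrow> (\<forall>m::int. (\<lambda>x. s x * cis (- of_int m * x)) integrable_on {0..2 * pi}) \<and>
     (\<exists>K. \<forall>n>0. \<forall>m. \<bar>m\<bar> < int n \<longrightarrow>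
        cmod (fourier_coeff m s - sampled_coeff n m s) \<le> K / (real n - \<bar>real_of_int m\<bar>))"

lemma sampled_coeff_add: "sampled_coeff n m (\<lambda>x. s x + u x) = sampled_coeff n m s + sampled_coeff n m u"
  by (simp add: sampled_coeff_def algebra_simps sum.distrib add_divide_distrib)

lemma sampled_coeff_cmult: "sampled_coeff n m (\<lambda>x. c * s x) = c * sampled_coeff n m s"
  by (simp add: sampled_coeff_def algebra_simps sum_distrib_left)

lemma fourier_coeff_add:
  assumes "(\<lambda>x. s x * cis (- of_int m * x)) integrable_on {0..2 * pi}"
    "(\<lambda>x. u x * cis (- of_int m * x)) integrable_on {0..2 * pi}"
  shows "fourier_coeff m (\<lambda>x. s x + u x) = fourier_coeff m s + fourier_coeff m u"
  using integral_add[OF assms] by (simp add: fourier_coeff_def distrib_right add_divide_distrib)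

lemma fourier_coeff_cmult: "fourier_coeff m (\<lambda>x. c * s x) = c * fourier_coeff m s"
  using integral_mult_right[of "{0..2 * pi}" c "\<lambda>x. s x * cis (- of_int m * x)"]
  by (simp add: fourier_coeff_def mult.assoc)

lemma small_aliasing_add:
  assumes "small_aliasing s" "small_aliasing u"
  shows "small_aliasing (\<lambda>x. s x + u x)"
proof -
  note int = assms[unfolded small_aliasing_def, THEN conjunct1, rule_format]
  obtain K where K: "\<And>n m. 0 < n \<Longrightarrow> \<bar>m\<bar> < int n \<Longrightarrow>
      cmod (fourier_coeff m s - sampled_coeff n m s) \<le> K / (real n - \<bar>real_of_int m\<bar>)"
    using assms(1) unfolding small_aliasing_def by blast
  obtain L where L: "\<And>n m. 0 < n \<Longrightarrow> \<bar>m\<bar> < int n \<Longrightarrow>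
      cmod (fourier_coeff m u - sampled_coeff n m u) \<le> L / (real n - \<bar>real_of_int m\<bar>)"
    using assms(2) unfolding small_aliasing_def by blast
  have "cmod (fourier_coeff m (\<lambda>x. s x + u x) - sampled_coeff n m (\<lambda>x. s x + u x)) \<le> (K + L) / (real n - \<bar>real_of_int m\<bar>)"
    if "0 < n" "\<bar>m\<bar> < int n" for n m
  proof -
    have "fourier_coeff m (\<lambda>x. s x + u x) - sampled_coeff n m (\<lambda>x. s x + u x)
      = (fourier_coeff m s - sampled_coeff n m s) + (fourier_coeff m u - sampled_coeff n m u)"
      by (simp add: fourier_coeff_add[OF int] sampled_coeff_add)
    then show ?thesis
      using norm_triangle_mono[OF K[OF that] L[OF that]] by (simp add: add_divide_distrib)
  qed
  moreover have "(\<lambda>x. (s x + u x) * cis (- of_int m * x)) integrable_on {0..2 * pi}" for m :: int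
    using integrable_add[OF int] by (simp add: distrib_right)
  ultimately show ?thesis unfolding small_aliasing_def by blast
qed

lemma small_aliasing_cmult:
  assumes "small_aliasing s"
  shows "small_aliasing (\<lambda>x. c * s x)"
proof -
  note int = assms[unfolded small_aliasing_def, THEN conjunct1, rule_format]
  obtain K where K: "\<And>n m. 0 < n \<Longrightarrow> \<bar>m\<bar> < int n \<Longrightarrow>
      cmod (fourier_coeff m s - sampled_coeff n m s) \<le> K / (real n - \<bar>real_of_int m\<bar>)"
    using assms unfolding small_aliasing_def by blast
  have "cmod (fourier_coeff m (\<lambda>x. c * s x) - sampled_coeff n m (\<lambda>x. c * s x)) \<le> (cmod c * K) / (real n - \<bar>real_of_int m\<bar>)"
    if "0 < n" "\<bar>m\<bar> < int n" for n m
    using mult_left_mono[OF K[OF that], of "cmod c"]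
    by (simp add: fourier_coeff_cmult sampled_coeff_cmult flip: right_diff_distrib norm_mult)
  moreover have "(\<lambda>x. (c * s x) * cis (- of_int m * x)) integrable_on {0..2 * pi}" for m :: int
    using integrable_on_mult_right[OF int, of c m] by (simp add: mult.assoc)
  ultimately show ?thesis unfolding small_aliasing_def by blast
qed

lemma has_integral_cis:
  assumes "m \<noteq> 0" "0 \<le> b"
  shows "((\<lambda>x. cis (- of_int m * x)) has_integral (1 - cis (- of_int m * b)) / (\<i> * of_int m)) {0..b}"
proof -
  have "((\<lambda>x. (1 - cis (- of_int m * x)) / (\<i> * of_int m)) has_vector_derivative cis (- of_int m * x))
      (at x within {0..b})" for x
  proof -
    have "((\<lambda>x. - of_int m * x) has_derivative (\<lambda>h. - of_int m * h)) (at x within {0..b})"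
      by (intro has_derivative_mult_right has_derivative_ident)
    from has_derivative_cis[OF this]
    have "((\<lambda>x. cis (- of_int m * x)) has_vector_derivative - of_int m *\<^sub>R (\<i> * cis (- of_int m * x))) (at x within {0..b})"
      by (simp add: has_vector_derivative_def mult_ac)
    from has_vector_derivative_mult_right[OF has_vector_derivative_diff[OF has_vector_derivative_const[of 1] this], of "1 / (\<i> * of_int m)"]
    show ?thesis using assms by (simp add: scaleR_conv_of_real)
  qed
  from fundamental_theorem_of_calculus[OF assms(2) this] show ?thesis by simp
qed

lemma has_integral_indicator_Ico:
  fixes h :: "real \<Rightarrow> complex"
  assumes "(h has_integral I) {0..b}" "b \<le> c"
  shows "((\<lambda>x. indicator {0..<b} x * h x) has_integral I) {0..c}"
proof -
  have "((\<lambda>x. if x \<in> {0..b} then h x else 0) has_integral I) {0..c}"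
    using assms by (subst has_integral_restrict) auto
  then show ?thesis
    by (rule has_integral_spike_finite[of "{b}", rotated 2]) (auto simp: indicator_def)
qed

lemma sampled_coeff_indicator:
  assumes b: "0 \<le> b" "b \<le> 2 * pi" and n: "0 < n"
  defines "K \<equiv> nat \<lceil>b * real n / (2 * pi)\<rceil>"
  shows "sampled_coeff n m (indicator {0..<b}) = (\<Sum>k<K. cis (- (2 * pi * of_int m / real n)) ^ k) / of_nat n"
proof -
  have iff: "2 * pi * real k / real n < b \<longleftrightarrow> k < K" for k
  proof -
    have "2 * pi * real k / real n < b \<longleftrightarrow> real k < b * real n / (2 * pi)"
      using n by (simp add: field_simps)
    also have "\<dots> \<longleftrightarrow> int k < \<lceil>b * real n / (2 * pi)\<rceil>"
      by (simp add: less_ceiling_iff)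
    finally show ?thesis by (simp only: K_def zless_nat_eq_int_zless)
  qed
  have "b * real n / (2 * pi) \<le> real n"
    using b n mult_right_mono[OF b(2), of "real n"] by (simp add: field_simps)
  then have "K \<le> n" unfolding K_def by (simp add: ceiling_le_iff nat_le_iff)
  have "(\<Sum>k<n. indicator {0..<b} (2 * pi * real k / real n) * cis (- of_int m * (2 * pi * real k / real n)))
      = (\<Sum>k<n. if k \<in> {..<K} then cis (- (2 * pi * of_int m / real n)) ^ k else 0)"
  proof (rule sum.cong[OF refl])
    fix k
    have "cis (- (2 * pi * of_int m / real n)) ^ k = cis (- of_int m * (2 * pi * real k / real n))"
      unfolding Complex.DeMoivre by (rule arg_cong[of _ _ cis]) (simp add: field_simps)
    then show "indicator {0..<b} (2 * pi * real k / real n) * cis (- of_int m * (2 * pi * real k / real n))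
      = (if k \<in> {..<K} then cis (- (2 * pi * of_int m / real n)) ^ k else 0)"
      using iff[of k] by (simp add: indicator_def)
  qed
  also have "\<dots> = (\<Sum>k\<in>{..<n} \<inter> {..<K}. cis (- (2 * pi * of_int m / real n)) ^ k)"
    by (rule sum.inter_restrict[symmetric]) simp
  also have "{..<n} \<inter> {..<K} = {..<K}" using \<open>K \<le> n\<close> by auto
  finally show ?thesis by (simp add: sampled_coeff_def)
qed

text \<open>
  If \<open>b\<close> is a grid point, both coefficients are \<open>1 - z ^ K\<close> divided by \<open>n\<close>, times \<open>1 / (\<i> t)\<close> or \<open>1 / (1 - z)\<close>, with \<open>t = 2\<pi>m / n\<close> and
  \<open>z = cis (- t)\<close>. Otherwise \<open>b\<close> is first moved to the next grid point \<open>b'\<close>; this leaves the samples unchanged and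
  moves the Fourier coefficient by at most \<open>1 / n\<close>.
\<close>
lemma small_aliasing_indicator_Ico_0:
  assumes b: "0 \<le> b" "b \<le> 2 * pi"
  shows "small_aliasing (indicator {0..<b})"
proof -
  have hi0: "((\<lambda>x. indicator {0..<b} x * cis (- of_int 0 * x)) has_integral of_real b) {0..2 * pi}"
    using has_integral_indicator_Ico[OF has_integral_const_real[of "1::complex" 0 b] b(2)] b
    by (simp add: scaleR_conv_of_real)
  have hi: "((\<lambda>x. indicator {0..<b} x * cis (- of_int m * x)) has_integral
      (1 - cis (- of_int m * b)) / (\<i> * of_int m)) {0..2 * pi}" if "m \<noteq> 0" for m :: int
    by (rule has_integral_indicator_Ico[OF has_integral_cis[OF that b(1)] b(2)])
  have "cmod (fourier_coeff m (indicator {0..<b}) - sampled_coeff n m (indicator {0..<b}))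
      \<le> (1 + pi) / (real n - \<bar>real_of_int m\<bar>)" if n: "0 < n" and m: "\<bar>m\<bar> < int n" for n m
  proof -
    have gap: "0 < real n - \<bar>real_of_int m\<bar>" using m by linarith
    have inv: "1 / real n \<le> 1 / (real n - \<bar>real_of_int m\<bar>)" using gap by (intro frac_le) auto
    define K where "K = nat \<lceil>b * real n / (2 * pi)\<rceil>"
    define b' where "b' = 2 * pi * real K / real n"
    have "\<bar>b * real n / (2 * pi) - real K\<bar> \<le> 1"
      using b by (simp add: K_def abs_le_iff) linarith
    then have "2 * pi / real n * \<bar>b * real n / (2 * pi) - real K\<bar> \<le> 2 * pi / real n * 1"
      by (intro mult_left_mono) auto
    also have "2 * pi / real n * \<bar>b * real n / (2 * pi) - real K\<bar> = \<bar>2 * pi / real n * (b * real n / (2 * pi) - real K)\<bar>"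
      by (simp add: abs_mult)
    also have "2 * pi / real n * (b * real n / (2 * pi) - real K) = b - b'"
      using n by (simp add: b'_def right_diff_distrib)
    finally have b': "\<bar>b - b'\<bar> \<le> 2 * pi / real n" by simp
    define t where "t = 2 * pi * of_int m / real n"
    \<comment> \<open>The sample points turn the exponentials of order \<open>m\<close> into the powers of \<open>z\<close>.\<close>
    define z where "z = cis (- t)"
    have sc: "sampled_coeff n m (indicator {0..<b}) = (\<Sum>k<K. z ^ k) / of_nat n"
      unfolding z_def t_def K_def by (rule sampled_coeff_indicator[OF b n])
    show ?thesis
    proof (cases "m = 0")
      case True
      have "fourier_coeff m (indicator {0..<b}) = of_real (b / (2 * pi))"
        using integral_unique[OF hi0] True by (simp add: fourier_coeff_def)
      moreover have "sampled_coeff n m (indicator {0..<b}) = of_real (b' / (2 * pi))"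
        using True n unfolding sc by (simp add: z_def t_def b'_def)
      ultimately have "cmod (fourier_coeff m (indicator {0..<b}) - sampled_coeff n m (indicator {0..<b}))
          = \<bar>b / (2 * pi) - b' / (2 * pi)\<bar>"
        by (metis norm_of_real of_real_diff)
      also have "\<dots> = \<bar>b - b'\<bar> / (2 * pi)" by (simp add: diff_divide_distrib[symmetric])
      also have "\<dots> \<le> (2 * pi / real n) / (2 * pi)" using b' by (intro divide_right_mono) auto
      also have "\<dots> = 1 / real n" by simp
      also have "\<dots> \<le> (1 + pi) / (real n - \<bar>real_of_int m\<bar>)"
        using inv gap by (simp add: add_divide_distrib add_increasing2)
      finally show ?thesis .
    next
      case False
      have t: "t \<noteq> 0" "\<bar>t\<bar> < 2 * pi"
        using False n m by (auto simp: t_def abs_mult field_simps)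
      define F where "F c = (1 - cis (- of_int m * c)) / (\<i> * of_int m) / complex_of_real (2 * pi)" for c
      have fc: "fourier_coeff m (indicator {0..<b}) = F b"
        using integral_unique[OF hi[OF False]] by (simp add: fourier_coeff_def F_def)
      have zK: "z ^ K = cis (- of_int m * b')"
        unfolding z_def Complex.DeMoivre b'_def t_def by (rule arg_cong[of _ _ cis]) simp
      have "cmod (F b - F b') \<le> 1 / real n"
      proof -
        have "F b - F b' = (cis (- of_int m * b') - cis (- of_int m * b)) / (\<i> * of_int m * complex_of_real (2 * pi))"
          by (simp add: F_def diff_divide_distrib)
        then have "cmod (F b - F b') = cmod (cis (- of_int m * b') - cis (- of_int m * b)) / (\<bar>of_int m\<bar> * (2 * pi))"
          by (simp add: norm_divide norm_mult)
        also have "\<dots> \<le> (\<bar>of_int m\<bar> * (2 * pi / real n)) / (\<bar>of_int m\<bar> * (2 * pi))"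
        proof (rule divide_right_mono)
          have "cmod (cis (- of_int m * b') - cis (- of_int m * b)) \<le> \<bar>of_int m * (b - b')\<bar>"
            using norm_cis_diff_le[of "- of_int m * b'" "- of_int m * b"] by (simp add: algebra_simps)
          also have "\<dots> \<le> \<bar>of_int m\<bar> * (2 * pi / real n)"
            unfolding abs_mult using b' by (intro mult_left_mono) auto
          finally show "cmod (cis (- of_int m * b') - cis (- of_int m * b)) \<le> \<bar>of_int m\<bar> * (2 * pi / real n)" .
        qed simp
        also have "\<dots> = 1 / real n" using False by simp
        finally show ?thesis .
      qed
      moreover have "cmod (F b' - sampled_coeff n m (indicator {0..<b})) \<le> pi / (real n - \<bar>real_of_int m\<bar>)"
      proof -
        have "z \<noteq> 1" using t cis_neq_1[of "- t"] by (simp add: z_def)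
        then have "sampled_coeff n m (indicator {0..<b}) = (1 - z ^ K) / of_nat n * (1 / (1 - z))"
          by (simp add: sc sum_gp_strict)
        moreover have "F b' = (1 - z ^ K) / of_nat n * (1 / (\<i> * t))"
          using n by (simp add: F_def zK t_def)
        ultimately have "F b' - sampled_coeff n m (indicator {0..<b})
            = (1 - z ^ K) / of_nat n * (1 / (\<i> * t) - 1 / (1 - cis (- t)))"
          by (simp only: right_diff_distrib z_def)
        then have "cmod (F b' - sampled_coeff n m (indicator {0..<b}))
            = cmod (1 - z ^ K) / real n * cmod (1 / (\<i> * t) - 1 / (1 - cis (- t)))"
          by (simp only: norm_mult norm_divide norm_of_nat)
        also have "\<dots> \<le> 2 / real n * (pi\<^sup>2 / (2 * pi - \<bar>t\<bar>))"
        proof (intro mult_mono norm_inverse_diff_le t divide_right_mono)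
          show "cmod (1 - z ^ K) \<le> 2"
            using norm_triangle_ineq4[of 1 "z ^ K"] by (simp add: zK)
        qed (use t in auto)
        also have "2 * pi - \<bar>t\<bar> = 2 * pi * (real n - \<bar>real_of_int m\<bar>) / real n"
          using n by (simp add: t_def abs_mult field_simps)
        also have "2 / real n * (pi\<^sup>2 / (2 * pi * (real n - \<bar>real_of_int m\<bar>) / real n)) = pi / (real n - \<bar>real_of_int m\<bar>)"
          using n gap by (simp add: power2_eq_square field_simps)
        finally show ?thesis .
      qed
      ultimately show ?thesis
        using norm_triangle_ineq[of "F b - F b'" "F b' - sampled_coeff n m (indicator {0..<b})"] inv
        by (simp add: fc add_divide_distrib)
    qed
  qed
  moreover have "(\<lambda>x. indicator {0..<b} x * cis (- of_int m * x)) integrable_on {0..2 * pi}" for m :: int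
    using hi[of m] hi0 by (cases "m = 0") blast+
  ultimately show ?thesis unfolding small_aliasing_def by blast
qed

lemma small_aliasing_indicator_point: "small_aliasing (indicator {a})"
proof -
  have hi: "((\<lambda>x. indicator {a} x * cis (- of_int m * x)) has_integral 0) {0..2 * pi}" for m :: int
    by (rule has_integral_spike_finite[of "{a}", OF _ _ has_integral_0]) auto
  have "cmod (fourier_coeff m (indicator {a}) - sampled_coeff n m (indicator {a}))
      \<le> 1 / (real n - \<bar>real_of_int m\<bar>)" if n: "0 < n" and m: "\<bar>m\<bar> < int n" for n m
  proof -
    define S where "S = {k. k < n \<and> 2 * pi * real k / real n = a}"
    have "card S \<le> card {nat \<lfloor>a * real n / (2 * pi)\<rfloor>}"
      using n by (intro card_mono) (auto simp: S_def)
    then have S: "card S \<le> 1" by simp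
    have "cmod (\<Sum>k<n. indicator {a} (2 * pi * real k / real n) * cis (- of_int m * (2 * pi * real k / real n)))
      \<le> (\<Sum>k<n. if k \<in> S then 1 else 0)"
      by (intro sum_norm_le) (auto simp: S_def indicator_def)
    also have "\<dots> = real (card ({..<n} \<inter> S))"
      by (subst sum.inter_restrict[symmetric]) auto
    also have "{..<n} \<inter> S = S" by (auto simp: S_def)
    also have "real (card S) \<le> 1" using S by simp
    finally have "cmod (sampled_coeff n m (indicator {a})) \<le> 1 / real n"
      by (simp add: sampled_coeff_def norm_divide divide_right_mono)
    also have "\<dots> \<le> 1 / (real n - \<bar>real_of_int m\<bar>)"
      using m by (intro frac_le) auto
    finally show ?thesis using integral_unique[OF hi] by (simp add: fourier_coeff_def)
  qed
  then show ?thesis unfolding small_aliasing_def using hi by blast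
qed

lemma small_aliasing_indicator_Ico:
  assumes "0 \<le> a" "a \<le> b" "b \<le> 2 * pi"
  shows "small_aliasing (indicator {a..<b})"
proof -
  have "small_aliasing (\<lambda>x. indicator {0..<b} x + (- 1) * indicator {0..<a} x)"
    using assms by (intro small_aliasing_add small_aliasing_cmult small_aliasing_indicator_Ico_0) auto
  also have "(\<lambda>x. indicator {0..<b} x + (- 1) * indicator {0..<a} x) = (indicator {a..<b} :: real \<Rightarrow> complex)"
    using assms by (auto simp: fun_eq_iff indicator_def)
  finally show ?thesis .
qed

section \<open>Functions with one-sided limits\<close>

lemma one_sided_neighbourhood:
  fixes f :: "real \<Rightarrow> complex"
  assumes "(f \<longlongrightarrow> l) (at_left x)" "(f \<longlongrightarrow> r) (at_right x)" "0 < e"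
  shows "\<exists>d>0. (\<forall>y. x - d < y \<longrightarrow> y < x \<longrightarrow> cmod (f y - l) < e)
    \<and> (\<forall>y. x < y \<longrightarrow> y < x + d \<longrightarrow> cmod (f y - r) < e)"
proof -
  have "eventually (\<lambda>y. cmod (f y - l) < e) (at_left x)"
    using tendstoD[OF assms(1,3)] by (simp add: dist_norm)
  then obtain a where a: "a < x" "\<And>y. a < y \<Longrightarrow> y < x \<Longrightarrow> cmod (f y - l) < e"
    by (auto simp: eventually_at_left_field)
  have "eventually (\<lambda>y. cmod (f y - r) < e) (at_right x)"
    using tendstoD[OF assms(2,3)] by (simp add: dist_norm)
  then obtain b where b: "x < b" "\<And>y. x < y \<Longrightarrow> y < b \<Longrightarrow> cmod (f y - r) < e"
    by (auto simp: eventually_at_right_field)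
  show ?thesis by (rule exI[of _ "min (x - a) (b - x)"]) (use a b in auto)
qed

text \<open>
  The usual compactness argument for regulated functions. Half-open pieces \<open>{a..<b}\<close> fit together without
  overlap; the value at the dividing point \<open>x\<close> is unrelated to the one-sided limits and gets a summand of its own.
\<close>
lemma regulated_step_approx:
  fixes f :: "real \<Rightarrow> complex"
  assumes reg: "\<And>x. 0 \<le> x \<Longrightarrow> x \<le> 2 * pi \<Longrightarrow> \<exists>l r. (f \<longlongrightarrow> l) (at_left x) \<and> (f \<longlongrightarrow> r) (at_right x)"
    and d: "0 < \<delta>"
  shows "\<exists>s. small_aliasing s \<and> (\<forall>x\<in>{0..2 * pi}. cmod (f x - s x) \<le> \<delta>)"
proof -
  define P where "P a b \<longleftrightarrow> (0 \<le> a \<longrightarrow> b \<le> 2 * pi \<longrightarrow>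
    (\<exists>s. small_aliasing s \<and> (\<forall>x. x \<notin> {a..<b} \<longrightarrow> s x = 0) \<and> (\<forall>x\<in>{a..<b}. cmod (f x - s x) \<le> \<delta>)))" for a b
  have "(0::real) \<le> 2 * pi" by simp
  then have "P 0 (2 * pi)"
  proof (induction rule: Bolzano)
    case (trans a b c)
    show ?case unfolding P_def
    proof (intro impI)
      assume "0 \<le> a" "c \<le> 2 * pi"
      then have ex: "\<exists>s. small_aliasing s \<and> (\<forall>x. x \<notin> {a..<b} \<longrightarrow> s x = 0) \<and> (\<forall>x\<in>{a..<b}. cmod (f x - s x) \<le> \<delta>)"
        "\<exists>s. small_aliasing s \<and> (\<forall>x. x \<notin> {b..<c} \<longrightarrow> s x = 0) \<and> (\<forall>x\<in>{b..<c}. cmod (f x - s x) \<le> \<delta>)"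
        using trans by (auto simp: P_def)
      from ex(1) obtain s where s: "small_aliasing s" "\<forall>x. x \<notin> {a..<b} \<longrightarrow> s x = 0"
          "\<forall>x\<in>{a..<b}. cmod (f x - s x) \<le> \<delta>"
        by (elim exE conjE)
      from ex(2) obtain u where u: "small_aliasing u" "\<forall>x. x \<notin> {b..<c} \<longrightarrow> u x = 0"
          "\<forall>x\<in>{b..<c}. cmod (f x - u x) \<le> \<delta>"
        by (elim exE conjE)
      show "\<exists>s. small_aliasing s \<and> (\<forall>x. x \<notin> {a..<c} \<longrightarrow> s x = 0) \<and> (\<forall>x\<in>{a..<c}. cmod (f x - s x) \<le> \<delta>)"
      proof (intro exI[of _ "\<lambda>x. s x + u x"] conjI allI impI ballI)
        show "small_aliasing (\<lambda>x. s x + u x)" by (rule small_aliasing_add[OF s(1) u(1)])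
        show "s x + u x = 0" if "x \<notin> {a..<c}" for x
        proof -
          have "x \<notin> {a..<b}" "x \<notin> {b..<c}" using that trans(3,4) by auto
          then show ?thesis using s(2) u(2) by simp
        qed
        show "cmod (f x - (s x + u x)) \<le> \<delta>" if "x \<in> {a..<c}" for x
        proof (cases "x < b")
          case True
          then have "x \<in> {a..<b}" "x \<notin> {b..<c}" using that by auto
          then show ?thesis using s(3) u(2) by simp
        next
          case False
          then have "x \<notin> {a..<b}" "x \<in> {b..<c}" using that by auto
          then show ?thesis using s(2) u(3) by simp
        qed
      qed
    qed
  next
    case (local x)
    then obtain l r where lr: "(f \<longlongrightarrow> l) (at_left x)" "(f \<longlongrightarrow> r) (at_right x)" using reg by blast
    obtain d where d0: "0 < d" and near: "\<And>y. x - d < y \<Longrightarrow> y < x \<Longrightarrow> cmod (f y - l) < \<delta>"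
      "\<And>y. x < y \<Longrightarrow> y < x + d \<Longrightarrow> cmod (f y - r) < \<delta>"
      using one_sided_neighbourhood[OF lr d] by blast
    have "P a b" if ab: "a \<le> x" "x \<le> b" "b - a < d" for a b
      unfolding P_def
    proof (intro impI)
      assume "0 \<le> a" "b \<le> 2 * pi"
      define s where "s = (\<lambda>y. l * indicator {a..<x} y + (r * indicator {x..<b} y
        + (if x < b then f x - r else 0) * indicator {x} y))"
      have "small_aliasing s"
        unfolding s_def using ab \<open>0 \<le> a\<close> \<open>b \<le> 2 * pi\<close>
        by (intro small_aliasing_add small_aliasing_cmult small_aliasing_indicator_Ico small_aliasing_indicator_point) auto
      moreover have "s y = 0" if "y \<notin> {a..<b}" for y
        using that ab by (auto simp: s_def indicator_def)
      moreover have "cmod (f y - s y) \<le> \<delta>" if "y \<in> {a..<b}" for y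
        using that ab near[of y] d by (cases y x rule: linorder_cases) (auto simp: s_def indicator_def)
      ultimately show "\<exists>s. small_aliasing s \<and> (\<forall>x. x \<notin> {a..<b} \<longrightarrow> s x = 0) \<and> (\<forall>x\<in>{a..<b}. cmod (f x - s x) \<le> \<delta>)"
        by blast
    qed
    then show ?case using d0 by blast
  qed
  then have "\<exists>s. small_aliasing s \<and> (\<forall>x. x \<notin> {0..<2 * pi} \<longrightarrow> s x = 0) \<and> (\<forall>x\<in>{0..<2 * pi}. cmod (f x - s x) \<le> \<delta>)"
    by (simp add: P_def)
  then obtain s where s: "small_aliasing s" "\<forall>x. x \<notin> {0..<2 * pi} \<longrightarrow> s x = 0"
      "\<forall>x\<in>{0..<2 * pi}. cmod (f x - s x) \<le> \<delta>"
    by (elim exE conjE)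
  show ?thesis
  proof (intro exI[of _ "\<lambda>x. s x + f (2 * pi) * indicator {2 * pi} x"] conjI ballI)
    show "small_aliasing (\<lambda>x. s x + f (2 * pi) * indicator {2 * pi} x)"
      by (rule small_aliasing_add[OF s(1) small_aliasing_cmult[OF small_aliasing_indicator_point]])
    show "cmod (f x - (s x + f (2 * pi) * indicator {2 * pi} x)) \<le> \<delta>" if "x \<in> {0..2 * pi}" for x
    proof (cases "x = 2 * pi")
      case True
      then show ?thesis using s(2) d by simp
    next
      case False
      then have "x \<in> {0..<2 * pi}" using that by auto
      then show ?thesis using False s(3) by simp
    qed
  qed
qed

text \<open>
  The same compactness argument; at each point both one-sided limits and the value are nonzero.
\<close>
lemma regulated_bounded_below:
  fixes f :: "real \<Rightarrow> complex"
  assumes reg: "\<And>x. 0 \<le> x \<Longrightarrow> x \<le> 2 * pi \<Longrightarrow> \<exists>l r. (f \<longlongrightarrow> l) (at_left x) \<and> (f \<longlongrightarrow> r) (at_right x)"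
    and nz: "without_zeros f"
  obtains c where "0 < c" "\<And>x. 0 \<le> x \<Longrightarrow> x \<le> 2 * pi \<Longrightarrow> c \<le> cmod (f x)"
proof -
  have "\<exists>c>0. \<forall>x\<in>{0..2 * pi}. c \<le> cmod (f x)"
  proof -
    define P where "P a b \<longleftrightarrow> (\<exists>c>0. \<forall>x\<in>{a..b}. c \<le> cmod (f x))" for a b
    have "(0::real) \<le> 2 * pi" by simp
    then have "P 0 (2 * pi)"
    proof (induction rule: Bolzano)
      case (trans a b c)
      then obtain u v where uv: "0 < u" "\<And>x. x \<in> {a..b} \<Longrightarrow> u \<le> cmod (f x)"
          "0 < v" "\<And>x. x \<in> {b..c} \<Longrightarrow> v \<le> cmod (f x)"
        unfolding P_def by blast
      have "min u v \<le> cmod (f x)" if "x \<in> {a..c}" for x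
        using uv(2)[of x] uv(4)[of x] that by (cases "x \<le> b") auto
      then show ?case unfolding P_def using uv by (intro exI[of _ "min u v"]) auto
    next
      case (local x)
      then obtain l r where lr: "(f \<longlongrightarrow> l) (at_left x)" "(f \<longlongrightarrow> r) (at_right x)" using reg by blast
      with nz have nz': "l \<noteq> 0" "r \<noteq> 0" "f x \<noteq> 0" unfolding without_zeros_def by auto
      define e where "e = min (cmod (f x)) (min (cmod l) (cmod r)) / 2"
      have e: "0 < e" "e \<le> cmod (f x) / 2" "e \<le> cmod l / 2" "e \<le> cmod r / 2" using nz' by (auto simp: e_def)
      obtain d where d: "0 < d" and near: "\<And>y. x - d < y \<Longrightarrow> y < x \<Longrightarrow> cmod (f y - l) < e"
        "\<And>y. x < y \<Longrightarrow> y < x + d \<Longrightarrow> cmod (f y - r) < e"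
        using one_sided_neighbourhood[OF lr e(1)] by blast
      have "e \<le> cmod (f y)" if "a \<le> x" "x \<le> b" "b - a < d" "y \<in> {a..b}" for a b y
      proof (cases y x rule: linorder_cases)
        case less
        then show ?thesis using near(1)[of y] that e norm_triangle_ineq2[of l "f y"] by (simp add: norm_minus_commute)
      next
        case equal then show ?thesis using e by auto
      next
        case greater
        then show ?thesis using near(2)[of y] that e norm_triangle_ineq2[of r "f y"] by (simp add: norm_minus_commute)
      qed
      then show ?case unfolding P_def using d e(1) by blast
    qed
    then show ?thesis by (simp add: P_def)
  qed
  then show thesis using that by auto
qed

lemma regulated_integrable:
  fixes f :: "real \<Rightarrow> complex" and m :: int
  assumes reg: "\<And>x. 0 \<le> x \<Longrightarrow> x \<le> 2 * pi \<Longrightarrow> \<exists>l r. (f \<longlongrightarrow> l) (at_left x) \<and> (f \<longlongrightarrow> r) (at_right x)"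
  shows "(\<lambda>x. f x * cis (- of_int m * x)) integrable_on {0..2 * pi}"
proof (rule integrable_uniform_limit_real)
  fix e :: real assume "0 < e"
  obtain s where s: "small_aliasing s" "\<And>x. x \<in> {0..2 * pi} \<Longrightarrow> cmod (f x - s x) \<le> e"
    using regulated_step_approx[OF reg \<open>0 < e\<close>] by blast
  have "norm (f x * cis (- of_int m * x) - s x * cis (- of_int m * x)) \<le> e" if "x \<in> {0..2 * pi}" for x
    using s(2)[of x] that by (simp add: norm_mult flip: left_diff_distrib)
  moreover have "(\<lambda>x. s x * cis (- of_int m * x)) integrable_on {0..2 * pi}"
    using s(1) by (simp add: small_aliasing_def)
  ultimately show "\<exists>g. (\<forall>x\<in>{0..2 * pi}. norm (f x * cis (- of_int m * x) - g x) \<le> e) \<and> g integrable_on {0..2 * pi}"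
    by (intro exI[of _ "\<lambda>x. s x * cis (- of_int m * x)"]) blast
qed

section \<open>Toeplitz and circulant matrices\<close>

definition coeff_mat :: "(int \<Rightarrow> complex) \<Rightarrow> nat \<Rightarrow> complex mat" where
  "coeff_mat c n = Matrix.mat n n (\<lambda>(j, k). c (int j - int k))"

lemma coeff_mat_carrier [simp]: "coeff_mat c n \<in> carrier_mat n n"
  by (simp add: coeff_mat_def)

lemma coeff_mat_index [simp]:
  "j < n \<Longrightarrow> k < n \<Longrightarrow> coeff_mat c n $$ (j, k) = c (int j - int k)"
  by (simp add: coeff_mat_def)

lemma coeff_mat_add: "coeff_mat (\<lambda>m. a m + b m) n = coeff_mat a n + coeff_mat b n"
  by (rule eq_matI) (auto simp: coeff_mat_def)

text \<open>
  Periodicity moves the interval of integration from \<open>{-\<pi>..\<pi>}\<close> to \<open>{0..2\<pi>}\<close>, where the sample points lie.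
\<close>
lemma toeplitz_mat_conv_coeff_mat:
  assumes per: "\<And>x. f (x + 2 * pi) = f x"
    and int: "\<And>m::int. (\<lambda>x. f x * cis (- of_int m * x)) integrable_on {0..2 * pi}"
  shows "toeplitz_mat f n = coeff_mat (\<lambda>m. fourier_coeff m f) n"
proof -
  have "integral {-pi..pi} (\<lambda>x. f x * cis (- of_int m * x)) = integral {0..2 * pi} (\<lambda>x. f x * cis (- of_int m * x))" for m :: int
  proof -
    let ?h = "\<lambda>x. f x * cis (- of_int m * x)"
    have hper: "?h (x + 2 * pi) = ?h x" for x
    proof -
      have "cis (- of_int m * (x + 2 * pi)) = cis (- of_int m * x) * cis (2 * pi * of_int (- m))"
        unfolding cis_mult by (simp add: algebra_simps)
      also have "cis (2 * pi * of_int (- m)) = 1" by (rule cis_multiple_2pi) simp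
      finally show ?thesis using per by simp
    qed
    have "?h integrable_on {0..pi}" "?h integrable_on {pi..2 * pi}"
      using integrable_subinterval_real[OF int[of m]] by auto
    then obtain I J where I: "(?h has_integral I) {0..pi}" and J: "(?h has_integral J) {pi..2 * pi}"
      by blast
    have "((\<lambda>x. ?h (x + 2 * pi)) has_integral J) {pi - 2 * pi..2 * pi - 2 * pi}"
      using has_integral_shift_real_ivl[OF J, of "2 * pi"] .
    then have J': "(?h has_integral J) {- pi..0}" unfolding hper by simp
    have "(?h has_integral J + I) {- pi..pi}"
      by (rule has_integral_combine[OF _ _ J' I]) auto
    moreover have "(?h has_integral I + J) {0..2 * pi}"
      by (rule has_integral_combine[OF _ _ I J]) auto
    ultimately show ?thesis by (simp add: integral_unique add.commute)
  qed
  note shift = this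
  have E: "exp (- \<i> * of_int m * complex_of_real x) = cis (- of_int m * x)" for m x
    by (simp add: cis_conv_exp mult_ac)
  show ?thesis
    unfolding toeplitz_mat_def coeff_mat_def fourier_coeff_def E shift
    by (rule eq_matI) (simp_all del: of_int_diff)
qed

lemma fourier_mat_carrier [simp]: "fourier_mat n \<in> carrier_mat n n"
  by (simp add: fourier_mat_def)

lemma dim_fourier_mat [simp]: "dim_row (fourier_mat n) = n" "dim_col (fourier_mat n) = n"
  by (simp_all add: fourier_mat_def)

lemma fourier_mat_index:
  assumes "j < n" "k < n"
  shows "fourier_mat n $$ (j, k) = cis (2 * pi * real (j * k) / real n) / complex_of_real (sqrt (real n))"
proof -
  have "exp (2 * complex_of_real pi * \<i> / of_nat n) = cis (2 * pi / real n)"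
    by (simp add: cis_conv_exp mult_ac)
  then show ?thesis
    using assms by (simp add: fourier_mat_def Complex.DeMoivre mult_ac)
qed

lemma of_real_sqrt_mult_self [simp]:
  "complex_of_real (sqrt (real n)) * complex_of_real (sqrt (real n)) = of_nat n"
  by (simp flip: of_real_mult)

lemma fourier_mat_unitary: "mat_adjoint (fourier_mat n) * fourier_mat n = 1\<^sub>m n"
proof (rule eq_matI)
  fix i j assume "i < dim_row (1\<^sub>m n :: complex mat)" "j < dim_col (1\<^sub>m n :: complex mat)"
  then have ij: "i < n" "j < n" by auto
  then have n: "0 < n" by simp
  define t where "t = 2 * pi * (real j - real i) / real n"
  have "(mat_adjoint (fourier_mat n) * fourier_mat n) $$ (i, j)
      = (\<Sum>k<n. fourier_mat n $$ (k, j) * cnj (fourier_mat n $$ (k, i)))"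
    using ij by (subst adjoint_mult_index) (auto simp: scalar_prod_def atLeast0LessThan)
  also have "\<dots> = (\<Sum>k<n. cis t ^ k / of_nat n)"
  proof (rule sum.cong[OF refl])
    fix k assume "k \<in> {..<n}"
    then have "fourier_mat n $$ (k, j) * cnj (fourier_mat n $$ (k, i))
        = cis (2 * pi * real (k * j) / real n) * cis (- (2 * pi * real (k * i) / real n))
          / complex_of_real (sqrt (real n) * sqrt (real n))"
      using ij by (simp add: fourier_mat_index cis_cnj)
    also have "cis (2 * pi * real (k * j) / real n) * cis (- (2 * pi * real (k * i) / real n)) = cis t ^ k"
      unfolding cis_mult Complex.DeMoivre t_def by (rule arg_cong[of _ _ cis]) (simp add: diff_divide_distrib algebra_simps)
    finally show "fourier_mat n $$ (k, j) * cnj (fourier_mat n $$ (k, i)) = cis t ^ k / of_nat n"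
      by (simp del: of_real_mult)
  qed
  also have "\<dots> = (if i = j then 1 else 0)"
  proof (cases "i = j")
    case True then show ?thesis using n by (simp add: t_def)
  next
    case False
    have "\<bar>real j - real i\<bar> < real n" using ij by (simp add: abs_less_iff)
    then have "t \<noteq> 0" "\<bar>t\<bar> < 2 * pi"
      using False n by (auto simp: t_def abs_mult pos_divide_less_eq)
    then have "cis t \<noteq> 1" by (rule cis_neq_1)
    moreover have "cis t ^ n = 1"
    proof -
      have "cis t ^ n = cis (2 * pi * of_int (int j - int i))"
        unfolding Complex.DeMoivre t_def using n by (intro arg_cong[of _ _ cis]) simp
      then show ?thesis by (simp only: cis_multiple_2pi Ints_of_int)
    qed
    ultimately show ?thesis using False by (simp add: sum_gp_strict flip: sum_divide_distrib)
  qed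
  finally show "(mat_adjoint (fourier_mat n) * fourier_mat n) $$ (i, j) = 1\<^sub>m n $$ (i, j)"
    using ij by simp
qed auto

lemma sample_diag_mat_carrier [simp]: "sample_diag_mat f n \<in> carrier_mat n n"
  by (simp add: sample_diag_mat_def)

lemma circulant_mat_carrier [simp]: "circulant_mat f n \<in> carrier_mat n n"
  by (simp add: circulant_mat_def)

text \<open>
  The exponentials of the two Fourier matrices combine to one that depends on \<open>j - k\<close> only. So the circulant
  matrix is a Toeplitz matrix as well, with Riemann sums in place of the Fourier integrals.
\<close>
lemma circulant_mat_conv_coeff_mat:
  "circulant_mat f n = coeff_mat (\<lambda>m. sampled_coeff n m f) n"
proof (rule eq_matI)
  fix j k assume "j < dim_row (coeff_mat (\<lambda>m. sampled_coeff n m f) n)" "k < dim_col (coeff_mat (\<lambda>m. sampled_coeff n m f) n)"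
  then have jk: "j < n" "k < n" by (auto simp: coeff_mat_def)
  let ?F = "fourier_mat n"
  have FL: "(mat_adjoint ?F * sample_diag_mat f n) $$ (j, l) = cnj (?F $$ (l, j)) * f (2 * pi * real l / real n)"
    if l: "l < n" for l
  proof -
    have "(mat_adjoint ?F * sample_diag_mat f n) $$ (j, l)
        = (\<Sum>p<n. cnj (?F $$ (p, j)) * (if p = l then f (2 * pi * real p / real n) else 0))"
      using jk l by (auto simp: scalar_prod_def atLeast0LessThan sample_diag_mat_def intro!: sum.cong)
    also have "\<dots> = (\<Sum>p<n. if p = l then cnj (?F $$ (p, j)) * f (2 * pi * real p / real n) else 0)"
      by (rule sum.cong) auto
    finally show ?thesis using l by simp
  qed
  have "circulant_mat f n $$ (j, k) = (\<Sum>l<n. (mat_adjoint ?F * sample_diag_mat f n) $$ (j, l) * ?F $$ (l, k))"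
    unfolding circulant_mat_def using jk
    by (subst index_mult_mat) (auto simp: scalar_prod_def atLeast0LessThan sample_diag_mat_def)
  also have "\<dots> = (\<Sum>l<n. f (2 * pi * real l / real n) * cis (- of_int (int j - int k) * (2 * pi * real l / real n)) / of_nat n)"
  proof (rule sum.cong[OF refl])
    fix l assume "l \<in> {..<n}"
    then have "(mat_adjoint ?F * sample_diag_mat f n) $$ (j, l) * ?F $$ (l, k)
       = f (2 * pi * real l / real n) * (cis (- (2 * pi * real (l * j) / real n)) * cis (2 * pi * real (l * k) / real n))
         / complex_of_real (sqrt (real n) * sqrt (real n))"
      using jk by (simp add: FL fourier_mat_index cis_cnj)
    also have "cis (- (2 * pi * real (l * j) / real n)) * cis (2 * pi * real (l * k) / real n)
       = cis (- of_int (int j - int k) * (2 * pi * real l / real n))"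
      unfolding cis_mult by (rule arg_cong[of _ _ cis]) (simp add: diff_divide_distrib algebra_simps)
    finally show "(mat_adjoint ?F * sample_diag_mat f n) $$ (j, l) * ?F $$ (l, k)
       = f (2 * pi * real l / real n) * cis (- of_int (int j - int k) * (2 * pi * real l / real n)) / of_nat n"
      by (simp del: of_real_mult)
  qed
  finally show "circulant_mat f n $$ (j, k) = coeff_mat (\<lambda>m. sampled_coeff n m f) n $$ (j, k)"
    using jk by (simp only: coeff_mat_index sampled_coeff_def sum_divide_distrib)
qed (simp_all add: circulant_mat_def coeff_mat_def fourier_mat_def)

lemma vnorm_circulant_le:
  assumes v: "v \<in> carrier_vec n" and b: "\<And>k. k < n \<Longrightarrow> cmod (f (2 * pi * real k / real n)) \<le> \<delta>" and d: "0 \<le> \<delta>"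
  shows "vnorm (circulant_mat f n *\<^sub>v v) \<le> \<delta> * vnorm v"
proof -
  let ?F = "fourier_mat n"
  have c: "mat_adjoint ?F \<in> carrier_mat n n" by simp
  define w where "w = ?F *\<^sub>v v"
  have w: "w \<in> carrier_vec n" unfolding w_def by (rule mult_mat_vec_carrier[OF fourier_mat_carrier v])
  define u where "u = sample_diag_mat f n *\<^sub>v w"
  have u: "u \<in> carrier_vec n" unfolding u_def by (rule mult_mat_vec_carrier[OF sample_diag_mat_carrier w])
  have "circulant_mat f n *\<^sub>v v = mat_adjoint ?F *\<^sub>v u"
    using assoc_mult_mat_vec[OF mult_square_carrier[OF c sample_diag_mat_carrier] fourier_mat_carrier v]
      assoc_mult_mat_vec[OF c sample_diag_mat_carrier w]
    by (simp add: circulant_mat_def u_def w_def)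
  then have "vnorm (circulant_mat f n *\<^sub>v v) = vnorm u"
    using vnorm_isometry[OF c _ u] unitary_right[OF fourier_mat_carrier fourier_mat_unitary] by simp
  also have "\<dots> \<le> \<delta> * vnorm w"
  proof -
    have ui: "u $ i = f (2 * pi * real i / real n) * w $ i" if "i < n" for i
    proof -
      have "u $ i = (\<Sum>k<n. (if i = k then f (2 * pi * real i / real n) else 0) * w $ k)"
        using that w by (auto simp: u_def sample_diag_mat_def scalar_prod_def atLeast0LessThan intro!: sum.cong)
      also have "\<dots> = (\<Sum>k<n. if k = i then f (2 * pi * real i / real n) * w $ k else 0)"
        by (rule sum.cong) auto
      finally show ?thesis using that by simp
    qed
    have "vnorm u \<le> L2_set (\<lambda>i. \<delta> * cmod (w $ i)) {0..<n}"
      unfolding vnorm_def using u ui b by (auto intro!: L2_set_mono mult_right_mono simp: norm_mult)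
    also have "\<dots> = \<delta> * vnorm w"
      using w d by (simp add: vnorm_def L2_set_right_distrib)
    finally show ?thesis .
  qed
  also have "vnorm w = vnorm v"
    unfolding w_def by (rule vnorm_isometry[OF fourier_mat_carrier fourier_mat_unitary v])
  finally show ?thesis .
qed

lemma circulant_mat_mult: "circulant_mat f n * circulant_mat g n = circulant_mat (\<lambda>x. f x * g x) n"
proof -
  let ?F = "fourier_mat n" and ?L = "\<lambda>f. sample_diag_mat f n"
  have c: "mat_adjoint ?F \<in> carrier_mat n n" by simp
  have diag: "?L f * ?L g = ?L (\<lambda>x. f x * g x)"
  proof (rule eq_matI)
    fix i j assume "i < dim_row (?L (\<lambda>x. f x * g x))" "j < dim_col (?L (\<lambda>x. f x * g x))"
    then have ij: "i < n" "j < n" by (auto simp: sample_diag_mat_def)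
    then have "(?L f * ?L g) $$ (i, j) = (\<Sum>k<n. (if i = k then f (2 * pi * real i / real n) else 0)
        * (if k = j then g (2 * pi * real k / real n) else 0))"
      by (auto simp: sample_diag_mat_def scalar_prod_def atLeast0LessThan intro!: sum.cong)
    also have "\<dots> = (\<Sum>k<n. if k = i then (if i = j then f (2 * pi * real i / real n) * g (2 * pi * real i / real n) else 0) else 0)"
      by (rule sum.cong) auto
    finally show "(?L f * ?L g) $$ (i, j) = ?L (\<lambda>x. f x * g x) $$ (i, j)"
      using ij by (simp add: sample_diag_mat_def)
  qed (auto simp: sample_diag_mat_def)
  have "circulant_mat f n * circulant_mat g n = mat_adjoint ?F * (?L f * ((?F * mat_adjoint ?F) * (?L g * ?F)))"
    unfolding circulant_mat_def by (simp add: assoc_mult_mat[of _ n n _ n _ n])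
  also have "\<dots> = mat_adjoint ?F * (?L f * ?L g) * ?F"
    using unitary_right[OF fourier_mat_carrier fourier_mat_unitary, of n]
    by (simp add: assoc_mult_mat[of _ n n _ n _ n] left_mult_one_mat[of _ n n])
  finally show ?thesis by (simp add: diag circulant_mat_def)
qed

lemma mat_inverse_circulant:
  assumes nz: "\<And>k. k < n \<Longrightarrow> f (2 * pi * real k / real n) \<noteq> 0"
  shows "circulant_mat (\<lambda>x. inverse (f x)) n * circulant_mat f n = 1\<^sub>m n" (is ?one)
    and "the (mat_inverse (circulant_mat f n)) = circulant_mat (\<lambda>x. inverse (f x)) n" (is ?inv)
proof -
  let ?C = "circulant_mat f n" and ?D = "circulant_mat (\<lambda>x. inverse (f x)) n"
  have "sample_diag_mat (\<lambda>x. inverse (f x) * f x) n = 1\<^sub>m n"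
    by (rule eq_matI) (use nz in \<open>auto simp: sample_diag_mat_def\<close>)
  then show DC: ?one
    unfolding circulant_mat_mult by (simp add: circulant_mat_def right_mult_one_mat[of _ n n] fourier_mat_unitary)
  have CD: "?C * ?D = 1\<^sub>m n"
    by (rule mat_mult_left_right_inverse[OF _ _ DC]) auto
  have "?C \<in> Units (ring_mat TYPE(complex) n ())"
    unfolding Units_def using CD DC by (auto simp: ring_mat_def intro!: bexI[of _ ?D])
  then obtain B where B: "mat_inverse ?C = Some B"
    using mat_inverse(1)[OF circulant_mat_carrier, where b = "()"] by (cases "mat_inverse ?C") auto
  then have "B * ?C = 1\<^sub>m n" "B \<in> carrier_mat n n"
    using mat_inverse(2)[OF circulant_mat_carrier] by auto
  then have "B = B * (?C * ?D)" by (simp add: CD)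
  also have "\<dots> = (B * ?C) * ?D"
    using \<open>B \<in> carrier_mat n n\<close> by (simp add: assoc_mult_mat[of _ n n _ n _ n])
  also have "\<dots> = ?D" using \<open>B * ?C = 1\<^sub>m n\<close> by (simp add: left_mult_one_mat[of _ n n])
  finally show ?inv by (simp add: B)
qed

section \<open>Norm bounds\<close>

definition trig_poly :: "complex vec \<Rightarrow> real \<Rightarrow> complex" where
  "trig_poly v x = (\<Sum>k<dim_vec v. v $ k * cis (real k * x))"

lemma has_integral_toeplitz_form:
  assumes int: "\<And>m::int. (\<lambda>x. g x * cis (- of_int m * x)) integrable_on {0..2 * pi}"
    and v: "v \<in> carrier_vec n" and w: "w \<in> carrier_vec n"
  shows "((\<lambda>x. g x * (trig_poly v x * cnj (trig_poly w x))) has_integral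
    complex_of_real (2 * pi) * ((coeff_mat (\<lambda>m. fourier_coeff m g) n *\<^sub>v v) \<bullet>c w)) {0..2 * pi}"
proof -
  have hi: "((\<lambda>x. g x * cis (- of_int m * x)) has_integral complex_of_real (2 * pi) * fourier_coeff m g) {0..2 * pi}" for m
    using integrable_integral[OF int[of m]] by (simp add: fourier_coeff_def)
  have "((\<lambda>x. \<Sum>j<n. \<Sum>k<n. (v $ k * cnj (w $ j)) * (g x * cis (- of_int (int j - int k) * x))) has_integral
    (\<Sum>j<n. \<Sum>k<n. (v $ k * cnj (w $ j)) * (complex_of_real (2 * pi) * fourier_coeff (int j - int k) g))) {0..2 * pi}"
    by (intro has_integral_sum has_integral_mult_right hi) auto
  moreover have "(\<Sum>j<n. \<Sum>k<n. (v $ k * cnj (w $ j)) * (g x * cis (- of_int (int j - int k) * x)))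
    = g x * (trig_poly v x * cnj (trig_poly w x))" for x
  proof -
    have "cis (- of_int (int j - int k) * x) = cis (real k * x) * cnj (cis (real j * x))" for j k
      by (simp add: cis_cnj cis_mult algebra_simps)
    then have "(\<Sum>j<n. \<Sum>k<n. (v $ k * cnj (w $ j)) * (g x * cis (- of_int (int j - int k) * x)))
      = (\<Sum>j<n. \<Sum>k<n. g x * ((v $ k * cis (real k * x)) * (cnj (w $ j) * cnj (cis (real j * x)))))"
      by (simp only: mult_ac)
    also have "\<dots> = g x * (\<Sum>j<n. \<Sum>k<n. (v $ k * cis (real k * x)) * (cnj (w $ j) * cnj (cis (real j * x))))"
      by (simp only: sum_distrib_left)
    also have "(\<Sum>j<n. \<Sum>k<n. (v $ k * cis (real k * x)) * (cnj (w $ j) * cnj (cis (real j * x))))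
      = trig_poly v x * cnj (trig_poly w x)"
    proof -
      have "trig_poly v x * cnj (trig_poly w x)
        = (\<Sum>k<n. \<Sum>j<n. (v $ k * cis (real k * x)) * (cnj (w $ j) * cnj (cis (real j * x))))"
        using v w by (simp add: trig_poly_def sum_product)
      also have "\<dots> = (\<Sum>j<n. \<Sum>k<n. (v $ k * cis (real k * x)) * (cnj (w $ j) * cnj (cis (real j * x))))"
        by (rule sum.swap)
      finally show ?thesis by (rule sym)
    qed
    finally show ?thesis .
  qed
  moreover have "(\<Sum>j<n. \<Sum>k<n. (v $ k * cnj (w $ j)) * (complex_of_real (2 * pi) * fourier_coeff (int j - int k) g))
    = complex_of_real (2 * pi) * ((coeff_mat (\<lambda>m. fourier_coeff m g) n *\<^sub>v v) \<bullet>c w)"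
    using v w by (simp add: coeff_mat_def scalar_prod_def atLeast0LessThan sum_distrib_left sum_distrib_right mult_ac)
  ultimately show ?thesis by (simp only:)
qed

lemma parseval_trig_poly:
  assumes v: "v \<in> carrier_vec n"
  shows "((\<lambda>x. (cmod (trig_poly v x))\<^sup>2) has_integral 2 * pi * (vnorm v)\<^sup>2) {0..2 * pi}"
proof -
  have hi: "((\<lambda>x. 1 * cis (- of_int m * x)) has_integral (if m = 0 then 2 * pi else 0)) {0..2 * pi}" for m :: int
  proof (cases "m = 0")
    case True
    then show ?thesis
      using has_integral_const_real[of "1::complex" 0 "2 * pi"] by (simp add: scaleR_conv_of_real)
  next
    case False
    have "cis (- of_int m * (2 * pi)) = cis (2 * pi * of_int (- m))" by (simp add: mult_ac)
    also have "\<dots> = 1" by (rule cis_multiple_2pi) simp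
    finally show ?thesis using has_integral_cis[OF False, of "2 * pi"] False by simp
  qed
  then have "fourier_coeff m (\<lambda>_. 1) = (if m = 0 then 1 else 0)" for m
    using integral_unique[OF hi[of m]] by (simp add: fourier_coeff_def)
  then have one: "coeff_mat (\<lambda>m. fourier_coeff m (\<lambda>_. 1)) n = 1\<^sub>m n"
    by (intro eq_matI) (auto simp: coeff_mat_def)
  have int: "(\<lambda>x. 1 * cis (- of_int m * x)) integrable_on {0..2 * pi}" for m :: int
    by (rule has_integral_integrable[OF hi])
  have "((\<lambda>x. 1 * (trig_poly v x * cnj (trig_poly v x))) has_integral complex_of_real (2 * pi) * (v \<bullet>c v)) {0..2 * pi}"
    using has_integral_toeplitz_form[OF int v v] v unfolding one by simp
  from has_integral_linear[OF this bounded_linear_Re]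
  show ?thesis
    by (simp add: self_scalar_prod_eq_vnorm o_def complex_mult_cnj cmod_power2)
qed

text \<open>
  With \<open>w = T v\<close>, the number \<open>2\<pi> \<parallel>w\<parallel>\<^sup>2\<close> is the integral of \<open>g p\<^sub>v\<close> times the conjugate of \<open>p\<^sub>w\<close>. The weighted arithmetic-geometric
  mean inequality \<open>\<delta> \<bar>p\<^sub>v\<bar> \<bar>p\<^sub>w\<bar> \<le> (\<delta>\<^sup>2 \<bar>p\<^sub>v\<bar>\<^sup>2 + \<bar>p\<^sub>w\<bar>\<^sup>2) / 2\<close> and Parseval then give \<open>\<parallel>w\<parallel>\<^sup>2 \<le> (\<delta>\<^sup>2 \<parallel>v\<parallel>\<^sup>2 + \<parallel>w\<parallel>\<^sup>2) / 2\<close>.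
\<close>
lemma vnorm_toeplitz_le:
  assumes int: "\<And>m::int. (\<lambda>x. g x * cis (- of_int m * x)) integrable_on {0..2 * pi}"
    and v: "v \<in> carrier_vec n" and b: "\<And>x. x \<in> {0..2 * pi} \<Longrightarrow> cmod (g x) \<le> \<delta>" and d: "0 \<le> \<delta>"
  shows "vnorm (coeff_mat (\<lambda>m. fourier_coeff m g) n *\<^sub>v v) \<le> \<delta> * vnorm v"
proof -
  define w where "w = coeff_mat (\<lambda>m. fourier_coeff m g) n *\<^sub>v v"
  have w: "w \<in> carrier_vec n" unfolding w_def by (rule mult_mat_vec_carrier[OF coeff_mat_carrier v])
  let ?h = "\<lambda>x. g x * (trig_poly v x * cnj (trig_poly w x))"
  let ?k = "\<lambda>x. (\<delta>\<^sup>2 * (cmod (trig_poly v x))\<^sup>2 + (cmod (trig_poly w x))\<^sup>2) / 2"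
  have h: "(?h has_integral complex_of_real (2 * pi) * complex_of_real ((vnorm w)\<^sup>2)) {0..2 * pi}"
    using has_integral_toeplitz_form[OF int v w] by (simp only: w_def[symmetric] self_scalar_prod_eq_vnorm)
  have k: "(?k has_integral (\<delta>\<^sup>2 * (2 * pi * (vnorm v)\<^sup>2) + 2 * pi * (vnorm w)\<^sup>2) / 2) {0..2 * pi}"
    by (intro has_integral_divide has_integral_add has_integral_mult_right parseval_trig_poly[OF v] parseval_trig_poly[OF w])
  have "norm (integral {0..2 * pi} ?h) \<le> integral {0..2 * pi} ?k"
  proof (rule integral_norm_bound_integral)
    show "norm (?h x) \<le> ?k x" if "x \<in> {0..2 * pi}" for x
    proof -
      have "norm (?h x) \<le> \<delta> * cmod (trig_poly v x) * cmod (trig_poly w x)"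
        using mult_right_mono[OF b[OF that], of "cmod (trig_poly v x) * cmod (trig_poly w x)"]
        by (simp add: norm_mult mult.assoc)
      also have "\<dots> \<le> ?k x"
        using sum_squares_bound[of "\<delta> * cmod (trig_poly v x)" "cmod (trig_poly w x)"]
        by (simp add: power_mult_distrib)
      finally show ?thesis .
    qed
  qed (use h k in blast)+
  also have "integral {0..2 * pi} ?k = pi * (\<delta>\<^sup>2 * (vnorm v)\<^sup>2 + (vnorm w)\<^sup>2)"
    using integral_unique[OF k] by (simp add: algebra_simps)
  also have "norm (integral {0..2 * pi} ?h) = pi * (2 * (vnorm w)\<^sup>2)"
    using integral_unique[OF h] by (simp add: norm_mult norm_power)
  finally have "(vnorm w)\<^sup>2 \<le> (\<delta> * vnorm v)\<^sup>2" by (simp add: power_mult_distrib)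
  then show ?thesis
    unfolding w_def[symmetric] by (rule power2_le_imp_le) (use d in simp)
qed

text \<open>
  The sum telescopes, because \<open>1 / x\<^sup>2 \<le> 2 / x - 2 / (x + 1)\<close> for \<open>x \<ge> 1\<close>.
\<close>
lemma sum_inverse_squares_le:
  assumes "0 < a"
  shows "(\<Sum>k<n. 1 / (real a + real k)\<^sup>2) \<le> 2 / real a"
proof -
  have "(\<Sum>k<n. 1 / (real a + real k)\<^sup>2) \<le> 2 / real a - 2 / (real a + real n)"
  proof (induction n)
    case (Suc n)
    have "1 / x\<^sup>2 \<le> 2 / x - 2 / (x + 1)" if "x \<ge> 1" for x :: real
    proof -
      have "2 / x - 2 / (x + 1) = 2 / (x * (x + 1))" using that by (simp add: field_simps)
      moreover have "x * (x + 1) \<le> 2 * x\<^sup>2"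
        using mult_left_mono[of "x + 1" "2 * x" x] that by (simp add: power2_eq_square)
      then have "2 / (2 * x\<^sup>2) \<le> 2 / (x * (x + 1))"
        using that by (intro frac_le) auto
      ultimately show ?thesis by simp
    qed
    from this[of "real a + real n"] show ?case using Suc assms by (simp add: add_ac)
  qed simp
  then show ?thesis by (smt (verit) divide_nonneg_nonneg of_nat_0_le_iff)
qed

lemma hankel_square_sum_le: "(\<Sum>j<n. \<Sum>k<n. 1 / (real (Suc j) + real k)\<^sup>2) \<le> 2 * harm n"
proof -
  have "(\<Sum>j<n. \<Sum>k<n. 1 / (real (Suc j) + real k)\<^sup>2) \<le> (\<Sum>j<n. 2 / real (Suc j))"
    by (intro sum_mono sum_inverse_squares_le) simp
  also have "\<dots> = 2 * (\<Sum>j<n. inverse (real (Suc j)))"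
    by (simp add: sum_distrib_left divide_inverse)
  also have "(\<Sum>j<n. inverse (real (Suc j))) = harm n"
    by (induction n) (simp_all add: harm_Suc, simp add: harm_def)
  finally show ?thesis .
qed

text \<open>
  In the lower left triangle the squared bound \<open>1 / (n - \<bar>j - k\<bar>)\<^sup>2\<close> is, read from the corner, the square of the Hilbert matrix
  entry \<open>1 / (j + k + 1)\<close>. In row \<open>j\<close> these squares sum up to at most \<open>2 / (j + 1)\<close>. The other triangle is the transpose.
\<close>
lemma frobenius_sq_coeff_mat_le:
  assumes c: "\<And>m. \<bar>m\<bar> < int n \<Longrightarrow> cmod (c m) \<le> K / (real n - \<bar>real_of_int m\<bar>)" and n: "0 < n"
  shows "frobenius_sq (coeff_mat c n) \<le> 4 * K\<^sup>2 * (1 + ln (real n))"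
proof -
  define H where "H = (\<Sum>j<n. \<Sum>k<n. 1 / (real (Suc j) + real k)\<^sup>2)"
  let ?a = "\<lambda>j k. 1 / (real n - real j + real k)\<^sup>2"
  have reflect: "(\<Sum>j<n. \<Sum>k<n. ?a j k) = H"
  proof -
    have "(\<Sum>j<n. \<Sum>k<n. ?a j k) = (\<Sum>j<n. \<Sum>k<n. ?a (n - Suc j) k)"
      by (rule sum.nat_diff_reindex[symmetric])
    also have "\<dots> = H"
      unfolding H_def by (intro sum.cong refl) (auto simp: of_nat_diff)
    finally show ?thesis .
  qed
  have "(cmod (coeff_mat c n $$ (j, k)))\<^sup>2 \<le> K\<^sup>2 * (?a j k + ?a k j)" if jk: "j < n" "k < n" for j k
  proof -
    have "cmod (c (int j - int k)) \<le> K / (real n - \<bar>real j - real k\<bar>)"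
      using c[of "int j - int k"] jk by simp
    then have "(cmod (c (int j - int k)))\<^sup>2 \<le> (K / (real n - \<bar>real j - real k\<bar>))\<^sup>2"
      by (intro power_mono) auto
    also have "\<dots> = K\<^sup>2 * (1 / (real n - \<bar>real j - real k\<bar>)\<^sup>2)"
      by (simp add: power_divide)
    also have "\<dots> \<le> K\<^sup>2 * (?a j k + ?a k j)"
    proof (rule mult_left_mono)
      show "1 / (real n - \<bar>real j - real k\<bar>)\<^sup>2 \<le> ?a j k + ?a k j"
      proof (cases "k \<le> j")
        case True
        then have "real n - \<bar>real j - real k\<bar> = real n - real j + real k" by simp
        then show ?thesis by (simp only: le_add_same_cancel1) simp
      next
        case False
        then have "real n - \<bar>real j - real k\<bar> = real n - real k + real j" by simp
        then show ?thesis by (simp only: le_add_same_cancel2) simp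
      qed
    qed simp
    finally show ?thesis using jk by simp
  qed
  then have "frobenius_sq (coeff_mat c n) \<le> (\<Sum>j<n. \<Sum>k<n. K\<^sup>2 * (?a j k + ?a k j))"
    unfolding frobenius_sq_def by (auto simp: coeff_mat_def intro!: sum_mono)
  also have "\<dots> = K\<^sup>2 * ((\<Sum>j<n. \<Sum>k<n. ?a j k) + (\<Sum>j<n. \<Sum>k<n. ?a k j))"
    by (simp only: sum_distrib_left sum.distrib distrib_left)
  also have "(\<Sum>j<n. \<Sum>k<n. ?a k j) = (\<Sum>j<n. \<Sum>k<n. ?a j k)" by (rule sum.swap)
  also have "K\<^sup>2 * ((\<Sum>j<n. \<Sum>k<n. ?a j k) + (\<Sum>j<n. \<Sum>k<n. ?a j k)) = 2 * K\<^sup>2 * H"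
    by (simp add: reflect)
  also have "\<dots> \<le> 2 * K\<^sup>2 * (2 * (1 + ln (real n)))"
  proof (rule mult_left_mono)
    have "harm n - ln (of_nat n) \<le> harm 1 - ln (of_nat 1 :: real)"
      by (rule euler_mascheroni_sequence_decreasing) (use n in auto)
    then have "harm n \<le> 1 + ln (real n)" by (simp add: harm_def)
    then show "H \<le> 2 * (1 + ln (real n))"
      using hankel_square_sum_le[of n] by (simp add: H_def)
  qed simp
  finally show ?thesis by (simp add: algebra_simps)
qed

lemma abs_vnorm_add_diff_le:
  assumes "v \<in> carrier_vec n" "w \<in> carrier_vec n"
  shows "\<bar>vnorm (v + w) - vnorm v\<bar> \<le> vnorm w"
proof -
  have "v = (v + w) + - w" using assms by auto
  then have "vnorm v \<le> vnorm (v + w) + vnorm (- w)"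
    using vnorm_add_le[of "v + w" n "- w"] assms by simp
  moreover have "vnorm (- w) = vnorm w"
    unfolding vnorm_def by (intro L2_set_cong) auto
  ultimately show ?thesis using vnorm_add_le[OF assms] by linarith
qed

section \<open>Counting the outliers\<close>

text \<open>
  The constants: \<open>\<delta> = c \<epsilon> / 4\<close>, so that the two matrices belonging to \<open>g = f - s\<close> together contribute at most
  \<open>2 \<delta> = c \<epsilon> / 2\<close> to the image of a unit vector. A deviation \<open>c \<epsilon>\<close> therefore leaves at least \<open>2 \<delta>\<close> to the matrix \<open>E\<close> of the step function \<open>s\<close>.
\<close>
lemma regulated_log_outliers:
  fixes f :: "real \<Rightarrow> complex"
  assumes per: "\<And>x. f (x + 2 * pi) = f x"
    and reg: "\<And>x. 0 \<le> x \<Longrightarrow> x \<le> 2 * pi \<Longrightarrow> \<exists>l r. (f \<longlongrightarrow> l) (at_left x) \<and> (f \<longlongrightarrow> r) (at_right x)"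
    and nz: "without_zeros f" and e: "0 < \<epsilon>"
  shows "\<exists>M. \<forall>n>0. real (size {# \<sigma> \<in># singular_values (preconditioned_mat f n). \<bar>\<sigma> - 1\<bar> > \<epsilon> #}) \<le> M * (1 + ln (real n))"
proof -
  obtain c where c: "0 < c" "\<And>x. 0 \<le> x \<Longrightarrow> x \<le> 2 * pi \<Longrightarrow> c \<le> cmod (f x)"
    using regulated_bounded_below[OF reg nz] by blast
  define \<delta> where "\<delta> = c * \<epsilon> / 4"
  have d: "0 < \<delta>" using c e by (simp add: \<delta>_def)
  obtain s where s: "small_aliasing s" and fs: "\<And>x. x \<in> {0..2 * pi} \<Longrightarrow> cmod (f x - s x) \<le> \<delta>"
    using regulated_step_approx[OF reg d] by blast
  obtain K where K: "\<And>n m. 0 < n \<Longrightarrow> \<bar>m\<bar> < int n \<Longrightarrow>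
      cmod (fourier_coeff m s - sampled_coeff n m s) \<le> K / (real n - \<bar>real_of_int m\<bar>)"
    using s unfolding small_aliasing_def by blast
  define g where "g x = f x - s x" for x
  have f_int: "(\<lambda>x. f x * cis (- of_int m * x)) integrable_on {0..2 * pi}" for m :: int
    by (rule regulated_integrable[OF reg])
  have s_int: "(\<lambda>x. s x * cis (- of_int m * x)) integrable_on {0..2 * pi}" for m :: int
    using s unfolding small_aliasing_def by blast
  have g_int: "(\<lambda>x. g x * cis (- of_int m * x)) integrable_on {0..2 * pi}" for m :: int
    using integrable_diff[OF f_int s_int] by (simp add: g_def left_diff_distrib)
  have f_sg: "f = (\<lambda>x. s x + g x)" by (simp add: g_def)
  have sample_range: "2 * pi * real k / real n \<in> {0..2 * pi}" if "k < n" for k n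
    using that by (simp add: pos_divide_le_eq)
  define M where "M = 4 * K\<^sup>2 / (2 * \<delta>)\<^sup>2"
  have "real (size {# \<sigma> \<in># singular_values (preconditioned_mat f n). \<bar>\<sigma> - 1\<bar> > \<epsilon> #}) \<le> M * (1 + ln (real n))"
    if n: "0 < n" for n
  proof -
    define C where "C = circulant_mat f n"
    define C' where "C' = circulant_mat (\<lambda>x. inverse (f x)) n"
    define E where "E = coeff_mat (\<lambda>m. fourier_coeff m s - sampled_coeff n m s) n"
    define N1 where "N1 = coeff_mat (\<lambda>m. fourier_coeff m g) n"
    \<comment> \<open>The sign makes the perturbation \<open>T - C\<close> a sum: \<open>E + (N1 + N2)\<close>.\<close>
    define N2 where "N2 = circulant_mat (\<lambda>x. (- 1) * g x) n"
    have carr: "C \<in> carrier_mat n n" "C' \<in> carrier_mat n n" "E \<in> carrier_mat n n" "N1 \<in> carrier_mat n n" "N2 \<in> carrier_mat n n"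
      by (simp_all add: C_def C'_def E_def N1_def N2_def)
    have nz': "f (2 * pi * real k / real n) \<noteq> 0" if "k < n" for k
      using nz unfolding without_zeros_def by blast
    have CC: "C' * C = 1\<^sub>m n"
      unfolding C_def C'_def by (rule mat_inverse_circulant(1)[where f = f and n = n, OF nz'])
    have split: "toeplitz_mat f n = C + (E + (N1 + N2))"
    proof -
      have "toeplitz_mat f n = coeff_mat (\<lambda>m. fourier_coeff m f) n"
        by (rule toeplitz_mat_conv_coeff_mat[OF per f_int])
      also have "(\<lambda>m. fourier_coeff m f) = (\<lambda>m. sampled_coeff n m f + ((fourier_coeff m s - sampled_coeff n m s)
          + (fourier_coeff m g + sampled_coeff n m (\<lambda>x. (- 1) * g x))))"
      proof
        fix m
        have "sampled_coeff n m (\<lambda>x. (- 1) * g x) = - sampled_coeff n m g"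
          using sampled_coeff_cmult[of n m "- 1" g] by simp
        then show "fourier_coeff m f = sampled_coeff n m f + ((fourier_coeff m s - sampled_coeff n m s)
          + (fourier_coeff m g + sampled_coeff n m (\<lambda>x. (- 1) * g x)))"
          by (simp only: f_sg fourier_coeff_add[OF s_int g_int] sampled_coeff_add) simp
      qed
      finally show ?thesis
        by (simp only: coeff_mat_add C_def E_def N1_def N2_def circulant_mat_conv_coeff_mat)
    qed
    define A where "A = preconditioned_mat f n"
    have A_eq: "A = C' * (C + (E + (N1 + N2)))"
      unfolding A_def preconditioned_mat_def split C'_def
      by (simp add: mat_inverse_circulant(2)[where f = f and n = n, OF nz'])
    have A: "A \<in> carrier_mat n n" using carr by (simp add: A_eq)
    \<comment> \<open>The matrix \<open>A\<close> maps \<open>v\<close> to \<open>v + C' (E + N1 + N2) v\<close>, and \<open>C'\<close> has norm at most \<open>1 / c\<close>.\<close>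
    have dev: "\<bar>vnorm (A *\<^sub>v v) - vnorm v\<bar> \<le> (vnorm (E *\<^sub>v v) + 2 * \<delta> * vnorm v) / c"
      if v: "v \<in> carrier_vec n" for v
    proof -
      define x y z where "x = E *\<^sub>v v" and "y = N1 *\<^sub>v v" and "z = N2 *\<^sub>v v"
      have xyz: "x \<in> carrier_vec n" "y \<in> carrier_vec n" "z \<in> carrier_vec n"
        using carr v by (auto simp: x_def y_def z_def)
      have Cv: "C *\<^sub>v v \<in> carrier_vec n" using carr v by auto
      have "A *\<^sub>v v = C' *\<^sub>v (C *\<^sub>v v + (x + (y + z)))"
        using carr v unfolding A_eq x_def y_def z_def
        by (simp add: assoc_mult_mat_vec[of _ n n _ n] add_mult_distrib_mat_vec[of _ n n])
      also have "\<dots> = C' *\<^sub>v (C *\<^sub>v v) + C' *\<^sub>v (x + (y + z))"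
        using carr Cv xyz by (intro mult_add_distrib_mat_vec[of _ n n]) auto
      also have "C' *\<^sub>v (C *\<^sub>v v) = v"
        using CC v assoc_mult_mat_vec[OF carr(2,1) v] by simp
      finally have "\<bar>vnorm (A *\<^sub>v v) - vnorm v\<bar> \<le> vnorm (C' *\<^sub>v (x + (y + z)))"
        using abs_vnorm_add_diff_le[OF v, of "C' *\<^sub>v (x + (y + z))"] carr xyz by auto
      also have "\<dots> \<le> 1 / c * vnorm (x + (y + z))"
        unfolding C'_def
      proof (rule vnorm_circulant_le)
        show "cmod (inverse (f (2 * pi * real k / real n))) \<le> 1 / c" if "k < n" for k
          using c(1) c(2)[of "2 * pi * real k / real n"] sample_range[OF that]
          by (auto simp: norm_divide inverse_eq_divide intro!: frac_le)
      qed (use xyz c in auto)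
      also have "\<dots> \<le> 1 / c * (vnorm x + (\<delta> * vnorm v + \<delta> * vnorm v))"
      proof (rule mult_left_mono)
        have "vnorm y \<le> \<delta> * vnorm v"
          unfolding y_def N1_def by (rule vnorm_toeplitz_le[OF g_int v]) (use fs d in \<open>auto simp: g_def\<close>)
        moreover have "vnorm z \<le> \<delta> * vnorm v"
          unfolding z_def N2_def
        proof (rule vnorm_circulant_le[OF v])
          show "cmod (- 1 * g (2 * pi * real k / real n)) \<le> \<delta>" if "k < n" for k
            using fs[OF sample_range[OF that]] by (simp add: g_def norm_minus_commute)
        qed (use d in simp)
        ultimately show "vnorm (x + (y + z)) \<le> vnorm x + (\<delta> * vnorm v + \<delta> * vnorm v)"
          using vnorm_add_le[of x n "y + z"] vnorm_add_le[of y n z] xyz by auto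
      qed (use c in simp)
      finally show ?thesis by (simp add: x_def mult.assoc)
    qed
    obtain U where U: "U \<in> carrier_mat n n" and UU: "mat_adjoint U * U = 1\<^sub>m n"
      and sv: "singular_values A = image_mset (\<lambda>i. vnorm (A *\<^sub>v col U i)) (mset_set {..<n})"
      by (rule singular_values_conv_vnorm[OF A])
    have unit: "vnorm (col U i) = 1" if "i < n" for i
    proof -
      have "complex_of_real ((vnorm (col U i))\<^sup>2) = (mat_adjoint U * U) $$ (i, i)"
        using U that by (subst adjoint_mult_index) (auto simp: self_scalar_prod_eq_vnorm)
      then have "(vnorm (col U i))\<^sup>2 = 1" using that unfolding UU by (simp add: flip: of_real_power)
      then show ?thesis by (simp add: power2_eq_1_iff) (smt (verit) vnorm_nonneg)
    qed
    have large: "2 * \<delta> \<le> vnorm (E *\<^sub>v col U i)" if "i < n" "\<bar>vnorm (A *\<^sub>v col U i) - 1\<bar> > \<epsilon>" for i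
    proof -
      have "\<epsilon> < (vnorm (E *\<^sub>v col U i) + 2 * \<delta>) / c"
        using dev[of "col U i"] unit[OF that(1)] that U by simp
      then have "c * \<epsilon> < vnorm (E *\<^sub>v col U i) + 2 * \<delta>"
        using c(1) by (simp add: field_simps)
      then show ?thesis by (simp add: \<delta>_def mult.commute)
    qed
    have "size {# \<sigma> \<in># singular_values A. \<bar>\<sigma> - 1\<bar> > \<epsilon> #} = card {i. i < n \<and> \<bar>vnorm (A *\<^sub>v col U i) - 1\<bar> > \<epsilon>}"
      by (simp add: sv filter_mset_image_mset)
    also have "\<dots> \<le> card {i. i < n \<and> 2 * \<delta> \<le> vnorm (E *\<^sub>v col U i)}"
      using large by (intro card_mono) auto
    finally have "real (size {# \<sigma> \<in># singular_values A. \<bar>\<sigma> - 1\<bar> > \<epsilon> #})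
        \<le> real (card {i. i < n \<and> 2 * \<delta> \<le> vnorm (E *\<^sub>v col U i)})" by simp
    also have "\<dots> \<le> frobenius_sq E / (2 * \<delta>)\<^sup>2"
      using d by (intro card_large_columns_le[OF carr(3) U UU]) simp
    also have "\<dots> \<le> (4 * K\<^sup>2 * (1 + ln (real n))) / (2 * \<delta>)\<^sup>2"
      unfolding E_def by (intro divide_right_mono frobenius_sq_coeff_mat_le K n) auto
    finally show ?thesis by (simp add: M_def A_def)
  qed
  then show ?thesis by blast
qed

text \<open>
  The points of discontinuity are listed in \<open>(0, 2\<pi>]\<close> only; the limits at \<open>0\<close> are those at \<open>2\<pi>\<close>.
\<close>
lemma piecewise_continuous_regulated:
  assumes per: "\<And>x. f (x + 2 * pi) = f x" and pc: "piecewise_continuous_with_jumps f \<nu> \<xi> \<alpha>"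
    and x: "0 \<le> x" "x \<le> 2 * pi"
  shows "\<exists>l r. (f \<longlongrightarrow> l) (at_left x) \<and> (f \<longlongrightarrow> r) (at_right x)"
proof -
  have *: "\<exists>l r. (f \<longlongrightarrow> l) (at_left x) \<and> (f \<longlongrightarrow> r) (at_right x)" if "0 < x" "x \<le> 2 * pi" for x
  proof (cases "isCont f x")
    case True
    then have "(f \<longlongrightarrow> f x) (at x)" by (simp add: isCont_def)
    then show ?thesis by (auto simp: filterlim_at_split)
  next
    case False
    then have "x \<in> \<xi> ` {1..\<nu>}" using pc that unfolding piecewise_continuous_with_jumps_def by auto
    then show ?thesis using pc unfolding piecewise_continuous_with_jumps_def by auto
  qed
  show ?thesis
  proof (cases "x = 0")
    case True
    obtain l r where lr: "(f \<longlongrightarrow> l) (at_left (2 * pi))" "(f \<longlongrightarrow> r) (at_right (2 * pi))"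
      using *[of "2 * pi"] by auto
    have "at_left (2 * pi) = filtermap (\<lambda>x. x + 2 * pi) (at_left 0)"
      using filtermap_at_left_shift[of "- (2 * pi)" 0] by simp
    then have "(f \<longlongrightarrow> l) (at_left 0)"
      using lr(1) per by (simp add: filterlim_filtermap)
    moreover have "(f \<longlongrightarrow> r) (at_right 0)"
      using lr(2) per by (simp add: filterlim_at_right_to_0[of _ _ "2 * pi"])
    ultimately show ?thesis using True by blast
  next
    case False then show ?thesis using * x by simp
  qed
qed

theorem mainTheorem11:
  fixes f :: "real \<Rightarrow> complex" and f\<^sub>1 f\<^sub>2 :: "real \<Rightarrow> real"
    and \<nu> :: nat and \<xi> :: "nat \<Rightarrow> real" and \<alpha> :: "nat \<Rightarrow> complex"
  assumes f: "\<And>x. f x = complex_of_real (f\<^sub>1 x) + \<i> * complex_of_real (f\<^sub>2 x)"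
    and f1_periodic: "\<And>x. f\<^sub>1 (x + 2 * pi) = f\<^sub>1 x" and f1_even: "\<And>x. f\<^sub>1 (- x) = f\<^sub>1 x"
    and f2_periodic: "\<And>x. f\<^sub>2 (x + 2 * pi) = f\<^sub>2 x" and f2_odd: "\<And>x. f\<^sub>2 (- x) = - f\<^sub>2 x"
    and pc: "piecewise_continuous_with_jumps f \<nu> \<xi> \<alpha>"
    and nz: "without_zeros f"
  shows "general_clustering (preconditioned_mat f) 1 \<and>
    (\<forall>\<epsilon>>0. (\<lambda>n. real (size {# \<sigma> \<in># singular_values (preconditioned_mat f n).
               \<sigma> \<notin> {1 - \<epsilon>..1 + \<epsilon>} #})) \<in> O(\<lambda>n. ln (real n)))"
proof -
  have per: "f (x + 2 * pi) = f x" for x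
    by (simp add: f f1_periodic f2_periodic)
  have log: "(\<lambda>n. real (size {# \<sigma> \<in># singular_values (preconditioned_mat f n). \<bar>\<sigma> - 1\<bar> > \<epsilon> #})) \<in> O(\<lambda>n. ln (real n))"
    if e: "0 < \<epsilon>" for \<epsilon>
  proof -
    obtain M where M: "\<And>n. 0 < n \<Longrightarrow>
        real (size {# \<sigma> \<in># singular_values (preconditioned_mat f n). \<bar>\<sigma> - 1\<bar> > \<epsilon> #}) \<le> M * (1 + ln (real n))"
      using regulated_log_outliers[OF per piecewise_continuous_regulated[OF per pc] nz e] by blast
    have "(\<lambda>n. real (size {# \<sigma> \<in># singular_values (preconditioned_mat f n). \<bar>\<sigma> - 1\<bar> > \<epsilon> #})) \<in> O(\<lambda>n. M * (1 + ln (real n)))"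
    proof (rule bigoI[of _ 1])
      show "eventually (\<lambda>n. norm (real (size {# \<sigma> \<in># singular_values (preconditioned_mat f n). \<bar>\<sigma> - 1\<bar> > \<epsilon> #}))
          \<le> 1 * norm (M * (1 + ln (real n)))) at_top"
        using eventually_gt_at_top[of 0] by eventually_elim (use M in \<open>fastforce intro: order.trans[OF _ abs_ge_self]\<close>)
    qed
    also have "(\<lambda>n. M * (1 + ln (real n))) \<in> O(\<lambda>n. ln (real n))"
      by real_asymp
    finally show ?thesis .
  qed
  have "(\<lambda>n. ln (real n)) \<in> o(\<lambda>n. real n)" by real_asymp
  then have "general_clustering (preconditioned_mat f) 1"
    unfolding general_clustering_def using log landau_o.big_small_trans by blast
  moreover have "\<sigma> \<notin> {1 - \<epsilon>..1 + \<epsilon>} \<longleftrightarrow> \<bar>\<sigma> - 1\<bar> > \<epsilon>" for \<sigma> \<epsilon> :: real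
    by auto
  ultimately show ?thesis using log by simp
qed

end
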